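(* Consider the problem whose instances are pairs $(\lambda,N)$, where $\lambda$ is a partition of rank less than three and $N\ge|\lambda|$ is a positive integer, and in which the quantity to be computed is $f^{\lambda,N}$. There is a fully polynomial randomized approximation scheme (FPRAS) for $f^{\lambda,N}$ on these instances.
   Context: A partition is a finite weakly decreasing sequence of positive integers $\lambda=(\lambda_1\ge\cdots\ge\lambda_\ell>0)$, identified with its Young diagram $\{(r,c): 1\le r\le \ell,\ 1\le c\le\lambda_r\}$ (left-justified boxes, rows numbered from the top, columns from the left). $|\lambda|$ is the number of boxes. The rank of a partition is the length of the main diagonal of its Young diagram, i.e. the number of boxes of the form $(i,i)$. For $N\ge|\lambda|$, an $N$-standard set-valued tableau of shape $\lambda$ is an assignment of a nonempty subset of $\{1,\ldots,N\}$ to each box of $\lambda$ such that each value in $\{1,\ldots,N\}$ appears exactly once overall and, whenever a single value is selected from each box, the resulting filling increases down each column and weakly increases from left to right along each row. Let $\mathsf{SVT}(\lambda,N)$ be the set of these, and $f^{\lambda,N}=|\mathsf{SVT}(\lambda,N)|$. A FPRAS for $f^{\lambda,N}$ is a randomized algorithm that, given an instance $(\lambda,N)$ and any $\epsilon,\delta\in(0,1]$, computes an approximation $A$ such that $P\big((1-\epsilon)f^{\lambda,N}\le A\le(1+\epsilon)f^{\lambda,N}\big)\ge 1-\delta$, in time polynomial in $|\lambda|$, $N$, $\frac1\epsilon$ and $\ln\delta^{-1}$. *)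

theory Defs
  imports "HOL-Probability.Probability_Mass_Function"
begin

section \<open>Partitions and standard set-valued tableaux\<close>

definition is_partition :: "nat list \<Rightarrow> bool" where
  "is_partition lam \<longleftrightarrow> sorted_wrt (\<ge>) lam \<and> (\<forall>p\<in>set lam. 0 < p)"

text \<open>Boxes are numbered from 1, list positions from 0.\<close>

definition diagram :: "nat list \<Rightarrow> (nat \<times> nat) set" where
  "diagram lam = {(r, c). 1 \<le> r \<and> r \<le> length lam \<and> 1 \<le> c \<and> c \<le> lam ! (r - 1)}"

definition num_boxes :: "nat list \<Rightarrow> nat" where
  "num_boxes lam = card (diagram lam)"

definition partition_rank :: "nat list \<Rightarrow> nat" where
  "partition_rank lam = card {i. (i, i) \<in> diagram lam}"

definition increasing_filling :: "nat list \<Rightarrow> (nat \<times> nat \<Rightarrow> nat) \<Rightarrow> bool" where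
  "increasing_filling lam t \<longleftrightarrow>
     (\<forall>r r' c. (r, c) \<in> diagram lam \<and> (r', c) \<in> diagram lam \<and> r < r' \<longrightarrow> t (r, c) < t (r', c)) \<and>
     (\<forall>r c c'. (r, c) \<in> diagram lam \<and> (r, c') \<in> diagram lam \<and> c < c' \<longrightarrow> t (r, c) \<le> t (r, c'))"

text \<open>
  A tableau is a total function on boxes; its value outside the diagram is fixed to be the empty
  set so that distinct functions are distinct tableaux.
\<close>

definition SVT :: "nat list \<Rightarrow> nat \<Rightarrow> (nat \<times> nat \<Rightarrow> nat set) set" where
  "SVT lam N = {T.
     (\<forall>b\<in>diagram lam. T b \<noteq> {} \<and> T b \<subseteq> {1..N}) \<and>
     (\<forall>b. b \<notin> diagram lam \<longrightarrow> T b = {}) \<and>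
     (\<forall>v\<in>{1..N}. \<exists>!b. b \<in> diagram lam \<and> v \<in> T b) \<and>
     (\<forall>t. (\<forall>b\<in>diagram lam. t b \<in> T b) \<longrightarrow> increasing_filling lam t)}"

definition num_SVT :: "nat list \<Rightarrow> nat \<Rightarrow> nat" where
  "num_SVT lam N = card (SVT lam N)"


section \<open>Randomized algorithms\<close>

text \<open>
  The machine model is a random access machine with a fair coin. It has registers and
  arrays, both named by numerals occurring in the (finite) program text, and each cell holds a
  natural number. Every instruction, and every test of a conditional or loop, takes one unit of
  time. As there is addition and (truncated) subtraction but no multiplication, numbers gain at
  most one bit per step, so that the unit-cost measure is polynomially related to running time
  on Turing machines.
\<close>

datatype instr =
    Const nat nat
  | Add nat nat nat
  | Sub nat nat nat
  | Load nat nat nat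
  | Store nat nat nat
  | Flip nat
  | IfNZ nat "instr list" "instr list"
  | WhileNZ nat "instr list"

type_synonym program = "instr list"

record state =
  reg :: "nat \<Rightarrow> nat"
  arr :: "nat \<Rightarrow> nat \<Rightarrow> nat"

definition set_reg :: "nat \<Rightarrow> nat \<Rightarrow> state \<Rightarrow> state" where
  "set_reg x v s = s\<lparr>reg := (reg s)(x := v)\<rparr>"

definition set_arr :: "nat \<Rightarrow> nat \<Rightarrow> nat \<Rightarrow> state \<Rightarrow> state" where
  "set_arr a i v s = s\<lparr>arr := (arr s)(a := (arr s a)(i := v))\<rparr>"

text \<open>
  A configuration consists of the instructions that remain to be executed and the current state.
  The machine has halted once no instructions remain.
\<close>

type_synonym config = "program \<times> state"

fun step :: "config \<Rightarrow> config pmf" where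
  "step ([], s) = return_pmf ([], s)"
| "step (Const x k # p, s) = return_pmf (p, set_reg x k s)"
| "step (Add x y z # p, s) = return_pmf (p, set_reg x (reg s y + reg s z) s)"
| "step (Sub x y z # p, s) = return_pmf (p, set_reg x (reg s y - reg s z) s)"
| "step (Load x a y # p, s) = return_pmf (p, set_reg x (arr s a (reg s y)) s)"
| "step (Store a y x # p, s) = return_pmf (p, set_arr a (reg s y) (reg s x) s)"
| "step (Flip x # p, s) =
     map_pmf (\<lambda>b. (p, set_reg x (of_bool b) s)) (bernoulli_pmf (1 / 2))"
| "step (IfNZ x p1 p2 # p, s) = return_pmf ((if reg s x \<noteq> 0 then p1 else p2) @ p, s)"
| "step (WhileNZ x p1 # p, s) =
     return_pmf (if reg s x \<noteq> 0 then p1 @ WhileNZ x p1 # p else p, s)"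

definition run :: "nat \<Rightarrow> config \<Rightarrow> config pmf" where
  "run n cfg = ((\<lambda>D. bind_pmf D step) ^^ n) (return_pmf cfg)"

definition halted :: "config \<Rightarrow> bool" where
  "halted cfg \<longleftrightarrow> fst cfg = []"


section \<open>Approximation schemes\<close>

text \<open>
  The accuracy parameters are arbitrary reals. An algorithm accesses such a real through its
  binary expansion; digit 0 is the one in front of the binary point.
\<close>

definition bin_digit :: "real \<Rightarrow> nat \<Rightarrow> nat" where
  "bin_digit x k = nat \<lfloor>x * 2 ^ k\<rfloor> mod 2"

definition input_state :: "nat list \<Rightarrow> nat \<Rightarrow> real \<Rightarrow> real \<Rightarrow> state" where
  "input_state lam N \<epsilon> \<delta> =
     \<lparr>reg = (\<lambda>_. 0)(0 := length lam, 1 := N),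
      arr = (\<lambda>_ _. 0)(0 := (\<lambda>i. if i < length lam then lam ! i else 0),
                      1 := bin_digit \<epsilon>,
                      2 := bin_digit \<delta>)\<rparr>"

text \<open>The computed approximation is a rational number, given by numerator and denominator.\<close>

definition result_value :: "state \<Rightarrow> real" where
  "result_value s = real (reg s 0) / real (reg s 1)"

text \<open>
  On every instance in the given set, and for every outcome of the coin flips, the program halts
  within the time bound, so the state after that many steps is the final one. The
  quantities in the time bound are nonnegative and their sum is at least 1, hence being bounded by
  a polynomial in the four quantities is the same as being bounded by a multiple of a power of the
  sum.
\<close>

definition is_FPRAS_SVT :: "(nat list \<times> nat) set \<Rightarrow> program \<Rightarrow> bool" where
  "is_FPRAS_SVT I p \<longleftrightarrow>
     (\<exists>C k :: nat. \<forall>(lam, N) \<in> I. \<forall>\<epsilon> \<in> {0<..1}. \<forall>\<delta> \<in> {0<..1}.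
        let T = nat \<lfloor>real C * (real (num_boxes lam) + real N + 1 / \<epsilon> + ln (1 / \<delta>)) ^ k\<rfloor>;
            D = run T (p, input_state lam N \<epsilon> \<delta>);
            f = real (num_SVT lam N)
        in (\<forall>cfg \<in> set_pmf D. halted cfg) \<and>
           measure_pmf.prob D
             {cfg. (1 - \<epsilon>) * f \<le> result_value (snd cfg) \<and> result_value (snd cfg) \<le> (1 + \<epsilon>) * f} \<ge> 1 - \<delta>)"

end

theory Submission imports Defs begin

text \<open>
  The number of tableaux can be computed exactly in polynomial time, without any coin flips.
  Inserting the values \<open>1, \<dots>, N\<close> one after the other, each value either opens a new box of the
  diagram or joins a box that is currently a corner. Hence \<open>f\<^sup>\<lambda>\<^sup>,\<^sup>N\<close> counts weighted walks of length \<open>N\<close>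
  from the empty partition to \<open>\<lambda>\<close> through the partitions contained in \<open>\<lambda>\<close>. If \<open>\<lambda>\<close> has rank less
  than three, these are described by four numbers: the lengths of the first two rows and of the
  parts of the first two columns below them. So there are at most \<open>(N + 1)\<^sup>4\<close> of them, and a
  dynamic program over all of these quadruples and all lengths of walks needs only additions.
\<close>

section \<open>Removing the largest value of a tableau\<close>

text \<open>Two obstacles shape the proof. A tableau is defined through all selections of one value
  per box, a condition that is awkward to restrict when the largest value is removed; it is first
  turned into comparisons between entries of two boxes in a common row or column. As every value
  occurs once, weak inequality down a column is already strict, so rows and columns play the same
  role and the recursion holds for every finite set of boxes. The other obstacle is the machine,
  which neither multiplies nor divides. The table is a single array addressed in base
  \<open>N + 1\<close>; this base suffices because each of the four lengths is at most
  \<open>num_boxes lam\<close>, hence at most \<open>N\<close>. A neighbour is then reached by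
  subtracting a fixed power of the base, and the digits of the current address are advanced by
  carrying instead of being recovered by division. Layers \<open>0\<close> to \<open>N\<close> make
  \<open>(N + 1) ^ 5\<close> cells, each filled in constant time, whence the exponent 5 of the time
  bound.\<close>

definition before :: "nat \<times> nat \<Rightarrow> nat \<times> nat \<Rightarrow> bool" where
  "before b b' \<longleftrightarrow> snd b = snd b' \<and> fst b < fst b' \<or> fst b = fst b' \<and> snd b < snd b'"

definition svt_on :: "(nat \<times> nat) set \<Rightarrow> nat \<Rightarrow> (nat \<times> nat \<Rightarrow> nat set) set" where
  "svt_on B N = {T.
     (\<forall>b\<in>B. T b \<noteq> {} \<and> T b \<subseteq> {1..N}) \<and>
     (\<forall>b. b \<notin> B \<longrightarrow> T b = {}) \<and>
     (\<forall>v\<in>{1..N}. \<exists>!b. b \<in> B \<and> v \<in> T b) \<and>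
     (\<forall>b\<in>B. \<forall>b'\<in>B. before b b' \<longrightarrow> (\<forall>x\<in>T b. \<forall>y\<in>T b'. x \<le> y))}"

definition corners :: "(nat \<times> nat) set \<Rightarrow> (nat \<times> nat) set" where
  "corners B = {b \<in> B. \<forall>b'\<in>B. \<not> before b b'}"

text \<open>From left to right, nonemptiness completes any two chosen entries to a full selection.
  From right to left, disjointness makes the two entries differ, which turns \<open><=\<close> into
  \<open><\<close> down a column.\<close>

lemma selections_increasing_iff:
  assumes ne: "\<And>b. b \<in> diagram lam \<Longrightarrow> T b \<noteq> {}"
    and disj: "\<And>b b' x. b \<in> diagram lam \<Longrightarrow> b' \<in> diagram lam \<Longrightarrow> x \<in> T b \<Longrightarrow> x \<in> T b' \<Longrightarrow> b = b'"
  shows "(\<forall>t. (\<forall>b\<in>diagram lam. t b \<in> T b) \<longrightarrow> increasing_filling lam t) \<longleftrightarrow>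
    (\<forall>b\<in>diagram lam. \<forall>b'\<in>diagram lam. before b b' \<longrightarrow> (\<forall>x\<in>T b. \<forall>y\<in>T b'. x \<le> y))"
proof (intro iffI ballI allI impI)
  fix b b' x y
  assume inc: "\<forall>t. (\<forall>b\<in>diagram lam. t b \<in> T b) \<longrightarrow> increasing_filling lam t"
    and b: "b \<in> diagram lam" "b' \<in> diagram lam" "before b b'" "x \<in> T b" "y \<in> T b'"
  define t where "t = (\<lambda>b. SOME z. z \<in> T b)(b := x, b' := y)"
  have neq: "b \<noteq> b'" using b(3) by (auto simp: before_def)
  have "t c \<in> T c" if "c \<in> diagram lam" for c
    using ne[OF that] b by (auto simp: t_def some_in_eq)
  then have "increasing_filling lam t" using inc by blast
  then have "t b \<le> t b'"
    using b(1-3) unfolding increasing_filling_def before_def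
    by (metis prod.collapse less_imp_le)
  then show "x \<le> y" using neq by (simp add: t_def)
next
  fix t
  assume le: "\<forall>b\<in>diagram lam. \<forall>b'\<in>diagram lam. before b b' \<longrightarrow> (\<forall>x\<in>T b. \<forall>y\<in>T b'. x \<le> y)"
    and t: "\<forall>b\<in>diagram lam. t b \<in> T b"
  have *: "t b \<le> t b'" if "b \<in> diagram lam" "b' \<in> diagram lam" "before b b'" for b b'
    using le t that by blast
  have neq: "t b \<noteq> t b'" if "b \<in> diagram lam" "b' \<in> diagram lam" "b \<noteq> b'" for b b'
    using disj t that by metis
  show "increasing_filling lam t"
    unfolding increasing_filling_def
  proof (intro conjI allI impI)
    fix r r' c
    assume a: "(r, c) \<in> diagram lam \<and> (r', c) \<in> diagram lam \<and> r < r'"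
    then have "t (r, c) \<le> t (r', c)" "t (r, c) \<noteq> t (r', c)"
      by (auto intro!: * simp: before_def neq)
    then show "t (r, c) < t (r', c)" by simp
  next
    fix r c c'
    assume "(r, c) \<in> diagram lam \<and> (r, c') \<in> diagram lam \<and> c < c'"
    then show "t (r, c) \<le> t (r, c')" by (auto intro!: * simp: before_def)
  qed
qed

lemma SVT_eq_svt_on: "SVT lam N = svt_on (diagram lam) N"
proof -
  have "T \<in> SVT lam N \<longleftrightarrow> T \<in> svt_on (diagram lam) N" for T
  proof (cases "(\<forall>b\<in>diagram lam. T b \<noteq> {} \<and> T b \<subseteq> {1..N}) \<and>
      (\<forall>v\<in>{1..N}. \<exists>!b. b \<in> diagram lam \<and> v \<in> T b)")
    case True
    then have ne: "\<And>b. b \<in> diagram lam \<Longrightarrow> T b \<noteq> {}" by simp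
    have disj: "b = b'"
      if "b \<in> diagram lam" "b' \<in> diagram lam" "x \<in> T b" "x \<in> T b'" for b b' x
    proof -
      have "x \<in> {1..N}" using True that(1,3) by (meson subsetD)
      then have "\<exists>!b. b \<in> diagram lam \<and> x \<in> T b" using True by simp
      then show ?thesis using that by (elim ex1E) metis
    qed
    note eq = selections_increasing_iff[where T = T, OF ne disj]
    show ?thesis
      unfolding SVT_def svt_on_def mem_Collect_eq by (simp only: eq)
  next
    case False
    then show ?thesis unfolding SVT_def svt_on_def mem_Collect_eq by argo
  qed
  then show ?thesis by blast
qed

lemma svt_onD:
  assumes "T \<in> svt_on B N"
  shows svt_on_nonempty: "b \<in> B \<Longrightarrow> T b \<noteq> {}"
    and svt_on_outside: "b \<notin> B \<Longrightarrow> T b = {}"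
    and svt_on_values: "T b \<subseteq> {1..N}"
    and svt_on_ex1: "v \<in> {1..N} \<Longrightarrow> \<exists>!b. b \<in> B \<and> v \<in> T b"
    and svt_on_le: "\<And>b b' x y. b \<in> B \<Longrightarrow> b' \<in> B \<Longrightarrow> before b b' \<Longrightarrow> x \<in> T b \<Longrightarrow> y \<in> T b' \<Longrightarrow> x \<le> y"
proof -
  from assms have *: "\<And>b. b \<in> B \<Longrightarrow> T b \<noteq> {} \<and> T b \<subseteq> {1..N}" "\<And>b. b \<notin> B \<Longrightarrow> T b = {}"
    "\<And>v. v \<in> {1..N} \<Longrightarrow> \<exists>!b. b \<in> B \<and> v \<in> T b"
    "\<And>b b' x y. b \<in> B \<Longrightarrow> b' \<in> B \<Longrightarrow> before b b' \<Longrightarrow> x \<in> T b \<Longrightarrow> y \<in> T b' \<Longrightarrow> x \<le> y"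
    by (simp_all add: svt_on_def del: split_paired_All)
  then show "b \<in> B \<Longrightarrow> T b \<noteq> {}" "b \<notin> B \<Longrightarrow> T b = {}"
    "v \<in> {1..N} \<Longrightarrow> \<exists>!b. b \<in> B \<and> v \<in> T b"
    "\<And>b b' x y. b \<in> B \<Longrightarrow> b' \<in> B \<Longrightarrow> before b b' \<Longrightarrow> x \<in> T b \<Longrightarrow> y \<in> T b' \<Longrightarrow> x \<le> y"
    by blast+
  show "T b \<subseteq> {1..N}" by (cases "b \<in> B") (use * in auto)
qed

lemma finite_svt_on:
  assumes "finite B"
  shows "finite (svt_on B N)"
proof (rule finite_subset)
  show "svt_on B N \<subseteq> {T. \<forall>b. (b \<in> B \<longrightarrow> T b \<in> Pow {1..N}) \<and> (b \<notin> B \<longrightarrow> T b = {})}"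
    by (auto simp: svt_on_def)
qed (use assms in \<open>intro finite_set_of_finite_funs; simp\<close>)

lemma card_svt_on_0: "card (svt_on B 0) = (if B = {} then 1 else 0)"
proof (cases "B = {}")
  case True
  then have "svt_on B 0 = {\<lambda>_. {}}" by (auto simp: svt_on_def)
  then show ?thesis using True by simp
next
  case False
  then have "svt_on B 0 = {}" by (auto simp: svt_on_def)
  then show ?thesis using False by simp
qed

lemma svt_on_disjoint:
  assumes "T \<in> svt_on B N" "x \<in> T b" "x \<in> T b'"
  shows "b = b'"
proof -
  have "b \<in> B" "b' \<in> B" using svt_on_outside[OF assms(1)] assms(2,3) by blast+
  moreover have "x \<in> {1..N}" using svt_on_values[OF assms(1)] assms(2) by blast
  ultimately show ?thesis using svt_on_ex1[OF assms(1)] assms(2,3) by blast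
qed

text \<open>\<open>Suc N\<close> exceeds every other value, so it could only violate a comparison as
  the left-hand entry; no box comes after a corner, so it never is one.\<close>

lemma svt_on_insert_old:
  assumes T: "T \<in> svt_on B N" and b: "b \<in> corners B"
  shows "T(b := insert (Suc N) (T b)) \<in> svt_on B (Suc N)"
proof -
  have bB: "b \<in> B" and nb: "\<And>c. c \<in> B \<Longrightarrow> \<not> before b c" using b by (auto simp: corners_def)
  have sub: "T c \<subseteq> {1..N}" for c using svt_on_values[OF T] .
  have ne: "T c \<noteq> {}" if "c \<in> B" for c using svt_on_nonempty[OF T] that by blast
  have out: "T c = {}" if "c \<notin> B" for c using svt_on_outside[OF T] that by blast
  have new: "Suc N \<notin> T c" for c using sub[of c] by auto
  have le: "x \<le> y" if "c \<in> B" "c' \<in> B" "before c c'" "x \<in> T c" "y \<in> T c'" for c c' x y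
    using svt_on_le[OF T] that by blast
  have ex: "\<exists>!c. c \<in> B \<and> v \<in> (T(b := insert (Suc N) (T b))) c" if "v \<in> {1..Suc N}" for v
  proof (cases "v = Suc N")
    case True
    then show ?thesis using bB new by (auto intro!: ex1I[of _ b])
  next
    case False
    then have "v \<in> {1..N}" using that by auto
    then have "\<exists>!c. c \<in> B \<and> v \<in> T c" using svt_on_ex1[OF T] by blast
    then show ?thesis using False by auto
  qed
  have le_Suc: "x \<le> Suc N" if "x \<in> T c" for x c using sub[of c] that by auto
  show ?thesis
    unfolding svt_on_def
  proof (intro CollectI conjI ballI allI impI)
    fix c assume "c \<in> B"
    then show "(T(b := insert (Suc N) (T b))) c \<noteq> {}" using ne by auto
    show "(T(b := insert (Suc N) (T b))) c \<subseteq> {1..Suc N}"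
      using sub[of c] by auto
  next
    fix c assume "c \<notin> B"
    then show "(T(b := insert (Suc N) (T b))) c = {}" using out bB by auto
  next
    fix v assume "v \<in> {1..Suc N}"
    then show "\<exists>!c. c \<in> B \<and> v \<in> (T(b := insert (Suc N) (T b))) c" by (rule ex)
  next
    fix c c' x y
    assume c: "c \<in> B" "c' \<in> B" "before c c'"
      and x: "x \<in> (T(b := insert (Suc N) (T b))) c" and y: "y \<in> (T(b := insert (Suc N) (T b))) c'"
    have "c \<noteq> b" using nb c by blast
    then have "x \<in> T c" using x by simp
    show "x \<le> y"
    proof (cases "y = Suc N")
      case True
      then show ?thesis using \<open>x \<in> T c\<close> by (simp add: le_Suc)
    next
      case False
      then have "y \<in> T c'" using y by (auto split: if_splits)
      then show ?thesis using le c \<open>x \<in> T c\<close> by blast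
    qed
  qed
qed

text \<open>Same argument as for \<open>svt_on_insert_old\<close>, but \<open>b\<close> is empty in
  \<open>T\<close> and receives \<open>Suc N\<close> alone.\<close>

lemma svt_on_insert_new:
  assumes T: "T \<in> svt_on (B - {b}) N" and b: "b \<in> corners B"
  shows "T(b := {Suc N}) \<in> svt_on B (Suc N)"
proof -
  have bB: "b \<in> B" and nb: "\<And>c. c \<in> B \<Longrightarrow> \<not> before b c" using b by (auto simp: corners_def)
  have sub: "T c \<subseteq> {1..N}" for c using svt_on_values[OF T] .
  have ne: "T c \<noteq> {}" if "c \<in> B" "c \<noteq> b" for c using svt_on_nonempty[OF T] that by blast
  have out: "T c = {}" if "c \<notin> B \<or> c = b" for c using svt_on_outside[OF T] that by blast
  have new: "Suc N \<notin> T c" for c using sub[of c] by auto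
  have le: "x \<le> y"
    if "c \<in> B" "c \<noteq> b" "c' \<in> B" "c' \<noteq> b" "before c c'" "x \<in> T c" "y \<in> T c'" for c c' x y
    using svt_on_le[OF T] that by blast
  have ex: "\<exists>!c. c \<in> B \<and> v \<in> (T(b := {Suc N})) c" if "v \<in> {1..Suc N}" for v
  proof (cases "v = Suc N")
    case True
    then show ?thesis using bB new by (auto intro!: ex1I[of _ b])
  next
    case False
    then have "v \<in> {1..N}" using that by auto
    then have "\<exists>!c. c \<in> B - {b} \<and> v \<in> T c" using svt_on_ex1[OF T] by blast
    then show ?thesis using False by auto
  qed
  have le_Suc: "x \<le> Suc N" if "x \<in> T c" for x c using sub[of c] that by auto
  show ?thesis
    unfolding svt_on_def
  proof (intro CollectI conjI ballI allI impI)
    fix c assume "c \<in> B"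
    then show "(T(b := {Suc N})) c \<noteq> {}" using ne by auto
    show "(T(b := {Suc N})) c \<subseteq> {1..Suc N}"
      using sub[of c] by auto
  next
    fix c assume "c \<notin> B"
    then show "(T(b := {Suc N})) c = {}" using out bB by auto
  next
    fix v assume "v \<in> {1..Suc N}"
    then show "\<exists>!c. c \<in> B \<and> v \<in> (T(b := {Suc N})) c" by (rule ex)
  next
    fix c c' x y
    assume c: "c \<in> B" "c' \<in> B" "before c c'"
      and x: "x \<in> (T(b := {Suc N})) c" and y: "y \<in> (T(b := {Suc N})) c'"
    have "c \<noteq> b" using nb c by blast
    then have "x \<in> T c" using x by simp
    show "x \<le> y"
    proof (cases "y = Suc N")
      case True
      then show ?thesis using \<open>x \<in> T c\<close> by (simp add: le_Suc)
    next
      case False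
      then have "y \<in> T c'" using y by (auto split: if_splits)
      then show ?thesis using le c \<open>x \<in> T c\<close> \<open>c \<noteq> b\<close> out by blast
    qed
  qed
qed

text \<open>Inverse of the two insertions; which one applies depends on whether the box of
  \<open>Suc N\<close> holds another value.\<close>

lemma svt_on_Suc_cases:
  assumes T: "T \<in> svt_on B (Suc N)"
  obtains b T' where "b \<in> corners B" "T' \<in> svt_on B N" "T = T'(b := insert (Suc N) (T' b))"
  | b T' where "b \<in> corners B" "T' \<in> svt_on (B - {b}) N" "T = T'(b := {Suc N})"
proof -
  have "\<exists>!b. b \<in> B \<and> Suc N \<in> T b" using svt_on_ex1[OF T, of "Suc N"] by simp
  then obtain b where b: "b \<in> B" "Suc N \<in> T b" by blast
  have uniq: "c = b" if "Suc N \<in> T c" for c using svt_on_disjoint[OF T that b(2)] .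
  have sub: "T c \<subseteq> {1..Suc N}" for c using svt_on_values[OF T] .
  have sub': "T c \<subseteq> {1..N}" if "c \<noteq> b" for c
    using sub[of c] uniq[of c] that by (auto simp: atLeastAtMostSuc_conv)
  have ne: "T c \<noteq> {}" if "c \<in> B" for c using svt_on_nonempty[OF T] that by blast
  have out: "T c = {}" if "c \<notin> B" for c using svt_on_outside[OF T] that by blast
  have ex: "\<exists>!c. c \<in> B \<and> v \<in> T c" if "v \<in> {1..N}" for v
    using svt_on_ex1[OF T] that by simp
  have le: "x \<le> y" if "c \<in> B" "c' \<in> B" "before c c'" "x \<in> T c" "y \<in> T c'" for c c' x y
    using svt_on_le[OF T] that by blast
  have corner: "b \<in> corners B"
    unfolding corners_def
  proof (intro CollectI conjI ballI notI b)
    fix c assume c: "c \<in> B" "before b c"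
    then obtain y where y: "y \<in> T c" using ne by blast
    then have "Suc N \<le> y" using le b c by blast
    moreover have "c \<noteq> b" using c by (auto simp: before_def)
    \<comment> \<open>A box after \<open>b\<close> would hold a value that is at least
      \<open>Suc N\<close>, hence \<open>Suc N\<close> itself, which occurs only in
      \<open>b\<close>.\<close>
    ultimately show False using sub'[of c] y by force
  qed
  define T' where "T' = T(b := T b - {Suc N})"
  have sub'': "T' c \<subseteq> {1..N}" for c
    using sub[of b] sub'[of c] by (auto simp: T'_def atLeastAtMostSuc_conv)
  have T'_iff: "v \<in> T' c \<longleftrightarrow> v \<in> T c" if "v \<in> {1..N}" for v c
    using that by (auto simp: T'_def)
  have T'_sub: "T' c \<subseteq> T c" for c by (auto simp: T'_def)
  show thesis
  proof (cases "T b = {Suc N}")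
    case True
    have T'b: "T' b = {}" using True by (simp add: T'_def)
    have ex': "\<exists>!c. c \<in> B - {b} \<and> v \<in> T' c" if "v \<in> {1..N}" for v
    proof -
      have "b \<noteq> c" if "v \<in> T' c" for c using that T'b by auto
      then show ?thesis using ex[OF \<open>v \<in> {1..N}\<close>] T'_iff[OF \<open>v \<in> {1..N}\<close>] by blast
    qed
    have "T' \<in> svt_on (B - {b}) N"
      unfolding svt_on_def
    proof (intro CollectI conjI ballI allI impI)
      fix c assume "c \<in> B - {b}"
      then show "T' c \<noteq> {}" using ne[of c] by (auto simp: T'_def)
    next
      fix c assume "c \<notin> B - {b}"
      then show "T' c = {}" using out[of c] T'b by (cases "c = b") (auto simp: T'_def)
    next
      fix v assume "v \<in> {1..N}"
      then show "\<exists>!c. c \<in> B - {b} \<and> v \<in> T' c" by (rule ex')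
    next
      fix c c' x y assume "c \<in> B - {b}" "c' \<in> B - {b}" "before c c'" "x \<in> T' c" "y \<in> T' c'"
      then show "x \<le> y" using le[of c c' x y] T'_sub by blast
    qed (rule sub'')
    moreover have "T = T'(b := {Suc N})"
      unfolding T'_def fun_upd_upd True[symmetric] by simp
    ultimately show thesis using that(2) corner by blast
  next
    case False
    have "T' \<in> svt_on B N"
      unfolding svt_on_def
    proof (intro CollectI conjI ballI allI impI)
      fix c assume "c \<in> B"
      then show "T' c \<noteq> {}" using ne[of c] False b by (auto simp: T'_def)
    next
      fix c assume "c \<notin> B"
      then show "T' c = {}" using out[of c] b by (auto simp: T'_def)
    next
      fix v assume "v \<in> {1..N}"
      then show "\<exists>!c. c \<in> B \<and> v \<in> T' c" using ex T'_iff by simp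
    next
      fix c c' x y assume "c \<in> B" "c' \<in> B" "before c c'" "x \<in> T' c" "y \<in> T' c'"
      then show "x \<le> y" using le[of c c' x y] T'_sub by blast
    qed (rule sub'')
    moreover have "T = T'(b := insert (Suc N) (T' b))"
      unfolding T'_def using b by (simp add: insert_absorb)
    ultimately show thesis using that(1) corner by blast
  qed
qed

text \<open>The largest value lies in a corner, either alone or together with smaller values.\<close>

lemma card_svt_on_Suc:
  assumes "finite B"
  shows "card (svt_on B (Suc N)) =
    (\<Sum>b\<in>corners B. card (svt_on (B - {b}) N) + card (svt_on B N))"
proof -
  define old where "old b = (\<lambda>T. T(b := insert (Suc N) (T b))) ` svt_on B N" for b
  define new where "new b = (\<lambda>T. T(b := {Suc N})) ` svt_on (B - {b}) N" for b
  have fin: "finite (corners B)" using assms by (simp add: corners_def)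
  have notin: "Suc N \<notin> T c" if "T \<in> svt_on C N" for T C c
    using svt_on_values[OF that, of c] by auto
  have union: "svt_on B (Suc N) = (\<Union>b\<in>corners B. new b \<union> old b)"
  proof (intro subset_antisym subsetI)
    fix T assume "T \<in> svt_on B (Suc N)"
    then show "T \<in> (\<Union>b\<in>corners B. new b \<union> old b)"
      by (rule svt_on_Suc_cases) (unfold old_def new_def, blast+)
  next
    fix T assume "T \<in> (\<Union>b\<in>corners B. new b \<union> old b)"
    then obtain b where "b \<in> corners B" "T \<in> new b \<or> T \<in> old b" by blast
    then show "T \<in> svt_on B (Suc N)"
      unfolding old_def new_def using svt_on_insert_old svt_on_insert_new by blast
  qed
  \<comment> \<open>The corner is recovered from \<open>T\<close> as the box of
    \<open>Suc N\<close>, so pieces belonging to different corners are disjoint.\<close>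
  have at: "Suc N \<in> T c \<longleftrightarrow> c = b" if "T \<in> new b \<union> old b" for T b c
  proof -
    obtain T' C where "T' \<in> svt_on C N"
      and T: "T = T'(b := {Suc N}) \<or> T = T'(b := insert (Suc N) (T' b))"
      using \<open>T \<in> new b \<union> old b\<close> unfolding new_def old_def by blast
    then have "Suc N \<notin> T' c" by (intro notin)
    then show ?thesis using T by (auto split: if_splits)
  qed
  \<comment> \<open>The two pieces at one corner differ in whether \<open>Suc N\<close> is alone
    there.\<close>
  have disj: "new b \<inter> old b = {}" if "b \<in> corners B" for b
  proof -
    have "T b \<noteq> {Suc N}" if "T \<in> old b" for T
    proof -
      obtain T' where T': "T' \<in> svt_on B N" "T = T'(b := insert (Suc N) (T' b))"
        using \<open>T \<in> old b\<close> unfolding old_def by blast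
      then have "T' b \<noteq> {}" using \<open>b \<in> corners B\<close> using svt_on_nonempty by (auto simp: corners_def)
      then show ?thesis using T' notin[OF T'(1), of b] by auto
    qed
    moreover have "T b = {Suc N}" if "T \<in> new b" for T using that by (auto simp: new_def)
    ultimately show ?thesis by blast
  qed
  have "inj_on (\<lambda>T. T(b := insert (Suc N) (T b))) (svt_on B N)" for b
  proof (rule inj_onI)
    fix T T' assume T: "T \<in> svt_on B N" "T' \<in> svt_on B N"
      and eq: "T(b := insert (Suc N) (T b)) = T'(b := insert (Suc N) (T' b))"
    have "T c = T' c" for c
      using fun_cong[OF eq, of c] notin[OF T(1), of c] notin[OF T(2), of c]
      by (cases "c = b") (auto simp: insert_ident)
    then show "T = T'" by blast
  qed
  then have card_old: "card (old b) = card (svt_on B N)" for b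
    by (simp add: old_def card_image)
  have "inj_on (\<lambda>T. T(b := {Suc N})) (svt_on (B - {b}) N)" for b
  proof (rule inj_onI)
    fix T T' assume T: "T \<in> svt_on (B - {b}) N" "T' \<in> svt_on (B - {b}) N"
      and eq: "T(b := {Suc N}) = T'(b := {Suc N})"
    have "T b = {}" "T' b = {}" using T svt_on_outside by blast+
    then have "T c = T' c" for c using fun_cong[OF eq, of c] by (cases "c = b") auto
    then show "T = T'" by blast
  qed
  then have card_new: "card (new b) = card (svt_on (B - {b}) N)" for b
    by (simp add: new_def card_image)
  have fin_old: "finite (old b)" and fin_new: "finite (new b)" for b
    using assms by (simp_all add: old_def new_def finite_svt_on)
  have "card (svt_on B (Suc N)) = (\<Sum>b\<in>corners B. card (new b \<union> old b))"
    unfolding union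
  proof (rule card_UN_disjoint[OF fin])
    show "\<forall>b\<in>corners B. finite (new b \<union> old b)" using fin_old fin_new by simp
    show "\<forall>b\<in>corners B. \<forall>c\<in>corners B. b \<noteq> c \<longrightarrow> (new b \<union> old b) \<inter> (new c \<union> old c) = {}"
    proof (intro ballI impI equals0I)
      fix b c T assume "b \<noteq> c" "T \<in> (new b \<union> old b) \<inter> (new c \<union> old c)"
      then show False using at[of T b b] at[of T c b] by blast
    qed
  qed
  also have "\<dots> = (\<Sum>b\<in>corners B. card (svt_on (B - {b}) N) + card (svt_on B N))"
    using disj fin_old fin_new by (intro sum.cong) (simp_all add: card_Un_disjoint card_old card_new)
  finally show ?thesis .
qed

section \<open>Partitions of rank less than three\<close>

definition boxes :: "nat \<Rightarrow> nat \<Rightarrow> nat \<Rightarrow> nat \<Rightarrow> (nat \<times> nat) set" where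
  "boxes p q s t = {1} \<times> {1..p} \<union> {2} \<times> {1..q} \<union> {3..s + 2} \<times> {1} \<union> {3..t + 2} \<times> {2}"

text \<open>A column part below row 2 must hang from a box of row 2, whence the bounds on
  \<open>q\<close>; \<open>t <= s\<close> keeps the lower rows left-justified.\<close>

definition is_shape :: "nat \<Rightarrow> nat \<Rightarrow> nat \<Rightarrow> nat \<Rightarrow> bool" where
  "is_shape p q s t \<longleftrightarrow> q \<le> p \<and> t \<le> s \<and> (0 < s \<longrightarrow> 1 \<le> q) \<and> (0 < t \<longrightarrow> 2 \<le> q)"

text \<open>
  The four conditions describe the corners only if \<open>is_shape p q s t\<close>. The values at other
  quadruples are meaningless, but removing a corner never leads from a shape to such a quadruple.
\<close>

fun walks :: "nat \<Rightarrow> nat \<Rightarrow> nat \<Rightarrow> nat \<Rightarrow> nat \<Rightarrow> nat" where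
  "walks 0 p q s t = (if p = 0 \<and> q = 0 \<and> s = 0 \<and> t = 0 then 1 else 0)"
| "walks (Suc v) p q s t =
     (if q < p then walks v (p - 1) q s t + walks v p q s t else 0) +
     (if of_bool (0 < s) + of_bool (0 < t) < q then walks v p (q - 1) s t + walks v p q s t else 0) +
     (if t < s then walks v p q (s - 1) t + walks v p q s t else 0) +
     (if 0 < t then walks v p q s (t - 1) + walks v p q s t else 0)"

lemma finite_boxes: "finite (boxes p q s t)"
  by (simp add: boxes_def)

lemma mem_boxes:
  "(r, c) \<in> boxes p q s t \<longleftrightarrow>
     r = 1 \<and> 1 \<le> c \<and> c \<le> p \<or> r = 2 \<and> 1 \<le> c \<and> c \<le> q \<or>
     3 \<le> r \<and> r \<le> s + 2 \<and> c = 1 \<or> 3 \<le> r \<and> r \<le> t + 2 \<and> c = 2"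
  by (auto simp: boxes_def)

text \<open>For the end of row 2, box \<open>(3, q)\<close> must be absent; since
  \<open>t <= s\<close>, the \<open>of_bool\<close> sum is the number of columns that continue below
  row 2, so \<open>q\<close> has to exceed it. The end of column 2 needs only \<open>0 < t\<close>,
  because no lower row reaches column 3.\<close>

lemma corners_boxes:
  assumes "is_shape p q s t"
  shows "corners (boxes p q s t) =
    (if q < p then {(1, p)} else {}) \<union>
    (if of_bool (0 < s) + of_bool (0 < t) < q then {(2, q)} else {}) \<union>
    (if t < s then {(s + 2, 1)} else {}) \<union>
    (if 0 < t then {(t + 2, 2)} else {})" (is "?L = ?R")
proof (rule set_eqI)
  fix b :: "nat \<times> nat"
  obtain r c where b: "b = (r, c)" by (cases b)
  have *: "(r, c) \<in> ?L \<longleftrightarrow> (r, c) \<in> boxes p q s t \<and>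
    (\<forall>k. r < k \<longrightarrow> (k, c) \<notin> boxes p q s t) \<and> (\<forall>k. c < k \<longrightarrow> (r, k) \<notin> boxes p q s t)"
    by (auto simp: corners_def before_def)
  have "of_bool (0 < s) + of_bool (0 < t) < q \<longleftrightarrow>
      0 < q \<and> (0 < s \<longrightarrow> 2 \<le> q) \<and> (0 < t \<longrightarrow> 3 \<le> q)"
    using assms by (cases "s = 0"; cases "t = 0") (auto simp: is_shape_def)
  then have R: "(r, c) \<in> ?R \<longleftrightarrow> r = 1 \<and> c = p \<and> q < p \<or>
    r = 2 \<and> c = q \<and> 0 < q \<and> (0 < s \<longrightarrow> 2 \<le> q) \<and> (0 < t \<longrightarrow> 3 \<le> q) \<or>
    r = s + 2 \<and> c = 1 \<and> t < s \<or> r = t + 2 \<and> c = 2 \<and> 0 < t"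
    by auto
  have "b \<in> ?R" if "b \<in> ?L"
  proof -
    have box: "(r, c) \<in> boxes p q s t"
      and nxt: "(Suc r, c) \<notin> boxes p q s t" "(r, Suc c) \<notin> boxes p q s t"
      using that unfolding b * by auto
    consider "r = 1" | "r = 2" | "3 \<le> r" "c = 1" | "3 \<le> r" "c = 2"
      using box by (auto simp: mem_boxes)
    then have "(r, c) \<in> ?R"
      unfolding R using box nxt assms
      by cases (simp_all add: mem_boxes is_shape_def, linarith+)
    then show ?thesis by (simp only: b)
  qed
  moreover have "b \<in> ?L" if "b \<in> ?R"
  proof -
    have "(r, c) \<in> ?R" using that by (simp only: b)
    then have "(r, c) \<in> ?L"
      unfolding * R mem_boxes is_shape_def using assms[unfolded is_shape_def]
      by presburger
    then show ?thesis by (simp only: b)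
  qed
  ultimately show "b \<in> ?L \<longleftrightarrow> b \<in> ?R" by blast
qed

lemma boxes_remove:
  shows "q < p \<Longrightarrow> boxes p q s t - {(1, p)} = boxes (p - 1) q s t"
    and "of_bool (0 < s) + of_bool (0 < t) < q \<Longrightarrow> boxes p q s t - {(2, q)} = boxes p (q - 1) s t"
    and "t < s \<Longrightarrow> boxes p q s t - {(s + 2, 1)} = boxes p q (s - 1) t"
    and "0 < t \<Longrightarrow> boxes p q s t - {(t + 2, 2)} = boxes p q s (t - 1)"
  by (auto simp: boxes_def)

lemma is_shape_remove:
  assumes "is_shape p q s t"
  shows "q < p \<Longrightarrow> is_shape (p - 1) q s t"
    and "of_bool (0 < s) + of_bool (0 < t) < q \<Longrightarrow> is_shape p (q - 1) s t"
    and "t < s \<Longrightarrow> is_shape p q (s - 1) t"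
    and "0 < t \<Longrightarrow> is_shape p q s (t - 1)"
  using assms by (auto simp: is_shape_def)

lemma card_svt_on_boxes:
  "is_shape p q s t \<Longrightarrow> card (svt_on (boxes p q s t) v) = walks v p q s t"
proof (induction v arbitrary: p q s t)
  case 0
  have "boxes p q s t = {} \<longleftrightarrow> p = 0 \<and> q = 0 \<and> s = 0 \<and> t = 0"
    by (auto simp: boxes_def)
  then show ?case by (simp add: card_svt_on_0)
next
  case (Suc v)
  define h where "h b = card (svt_on (boxes p q s t - {b}) v) + card (svt_on (boxes p q s t) v)" for b
  have "card (svt_on (boxes p q s t) (Suc v)) = sum h (corners (boxes p q s t))"
    by (simp add: card_svt_on_Suc finite_boxes h_def)
  also have "\<dots> =
     (if q < p then h (1, p) else 0) +
     (if of_bool (0 < s) + of_bool (0 < t) < q then h (2, q) else 0) +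
     (if t < s then h (s + 2, 1) else 0) +
     (if 0 < t then h (t + 2, 2) else 0)"
    \<comment> \<open>The four candidates are distinct: the guards force \<open>0 < s\<close> and
      \<open>0 < t\<close> for the last two, so these lie in row 3 or lower, in different
      columns.\<close>
    unfolding corners_boxes[OF Suc.prems]
    by (subst sum.union_disjoint, simp, simp, (force split: if_splits)?)+ simp
  also have "\<dots> = walks (Suc v) p q s t"
    unfolding walks.simps
    by (intro arg_cong2[where f = "(+)"] if_cong refl)
      (simp_all add: h_def boxes_remove Suc.IH Suc.prems is_shape_remove[OF Suc.prems] del: One_nat_def add_2_eq_Suc')
  finally show ?case .
qed

section \<open>Reading the four parameters off a partition\<close>

definition column2 :: "nat list \<Rightarrow> nat" where
  "column2 lam = length (filter (\<lambda>x. 2 \<le> x) lam)"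

text \<open>Rows of length at least 2 form an initial segment of a weakly decreasing list, so their
  number tells which rows they are.\<close>

lemma less_column2_iff:
  assumes "sorted_wrt (\<ge>) lam" "i < length lam"
  shows "i < column2 lam \<longleftrightarrow> 2 \<le> lam ! i"
  using assms
proof (induction lam arbitrary: i)
  case (Cons x xs)
  show ?case
  proof (cases "2 \<le> x")
    case True
    then show ?thesis using Cons by (cases i) (auto simp: column2_def)
  next
    case False
    have "\<forall>y\<in>set (x # xs). y \<le> x" using Cons.prems(1) by auto
    then have "filter (\<lambda>x. 2 \<le> x) (x # xs) = []" and "(x # xs) ! i \<le> x"
      using False nth_mem[OF Cons.prems(2)] by (auto simp: filter_empty_conv)
    then show ?thesis using False by (simp add: column2_def del: filter.simps)
  qed
qed simp

text \<open>Padding with 0 matches the input array, which is 0 beyond the last row; a missing first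
  or second row then has length 0.\<close>

definition row_len :: "nat list \<Rightarrow> nat \<Rightarrow> nat" where
  "row_len lam i = (if i < length lam then lam ! i else 0)"

lemma row_len_antimono:
  assumes "is_partition lam" "i \<le> j"
  shows "row_len lam j \<le> row_len lam i"
  using assms by (cases "i = j") (auto simp: row_len_def is_partition_def sorted_wrt_iff_nth_less)

lemma mem_diagram_iff: "(r, c) \<in> diagram lam \<longleftrightarrow> 1 \<le> r \<and> 1 \<le> c \<and> c \<le> row_len lam (r - 1)"
  by (auto simp: diagram_def row_len_def)

lemma row_len_pos_iff: "is_partition lam \<Longrightarrow> 0 < row_len lam i \<longleftrightarrow> i < length lam"
  by (auto simp: row_len_def is_partition_def)

lemma finite_diagram: "finite (diagram lam)"
proof (rule finite_subset)
  show "diagram lam \<subseteq> (SIGMA r : {1..length lam}. {1..lam ! (r - 1)})"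
    by (auto simp: diagram_def)
qed simp

text \<open>A longer third row would force the diagonal boxes \<open>(1, 1)\<close>,
  \<open>(2, 2)\<close> and \<open>(3, 3)\<close>. This is where the rank bound enters.\<close>

lemma row_len_2_le:
  assumes "is_partition lam" "partition_rank lam < 3"
  shows "row_len lam 2 \<le> 2"
proof (rule ccontr)
  assume "\<not> row_len lam 2 \<le> 2"
  then have "3 \<le> row_len lam 2" by simp
  moreover have "row_len lam 2 \<le> row_len lam 1" "row_len lam 1 \<le> row_len lam 0"
    using row_len_antimono assms by auto
  ultimately have sub: "{1, 2, 3} \<subseteq> {i. (i, i) \<in> diagram lam}"
    by (auto simp: mem_diagram_iff)
  have "finite {i. (i, i) \<in> diagram lam}"
    using finite_diagram[of lam] by (rule finite_vimageI[where h = "\<lambda>i. (i, i)", unfolded vimage_def]) (auto simp: inj_def)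
  then have "card {1::nat, 2, 3} \<le> partition_rank lam"
    unfolding partition_rank_def using sub by (rule card_mono)
  then show False using assms by simp
qed

text \<open>From row 3 on, a row has length at most 2, so it is determined by whether
  \<open>length lam\<close> and \<open>column2 lam\<close> reach it. Truncated subtraction gives
  empty column parts when there are fewer than two rows.\<close>

lemma diagram_eq_boxes:
  assumes "is_partition lam" "partition_rank lam < 3"
  shows "is_shape (row_len lam 0) (row_len lam 1) (length lam - 2) (column2 lam - 2)"
    and "diagram lam = boxes (row_len lam 0) (row_len lam 1) (length lam - 2) (column2 lam - 2)"
proof -
  have col2: "i < column2 lam \<longleftrightarrow> 2 \<le> row_len lam i" for i
  proof (cases "i < length lam")
    case True
    then show ?thesis using less_column2_iff assms(1) by (simp add: row_len_def is_partition_def)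
  next
    case False
    then show ?thesis
      by (simp add: row_len_def column2_def) (meson length_filter_le le_trans not_less)
  qed
  have len: "i < length lam \<longleftrightarrow> 1 \<le> row_len lam i" for i
    using row_len_pos_iff[OF assms(1), of i] by auto
  have anti: "row_len lam j \<le> row_len lam i" if "i \<le> j" for i j using row_len_antimono assms that by auto
  have "column2 lam \<le> length lam" by (simp add: column2_def)
  moreover have "2 < length lam \<Longrightarrow> 1 \<le> row_len lam 1" "2 < column2 lam \<Longrightarrow> 2 \<le> row_len lam 1"
    using len[of 1] col2[of 1] by auto
  ultimately show "is_shape (row_len lam 0) (row_len lam 1) (length lam - 2) (column2 lam - 2)"
    using anti[of 0 1] by (auto simp: is_shape_def)
  have "(r, c) \<in> diagram lam \<longleftrightarrow>
    (r, c) \<in> boxes (row_len lam 0) (row_len lam 1) (length lam - 2) (column2 lam - 2)" for r c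
  proof -
    consider "r = 0" | "r = 1" | "r = 2" | "3 \<le> r" by linarith
    then show ?thesis
    proof cases
      case 4
      then have "row_len lam (r - 1) \<le> row_len lam 2" by (intro anti) simp
      then have "row_len lam (r - 1) \<le> 2"
        using row_len_2_le[OF assms] by simp
      then have "1 \<le> c \<and> c \<le> row_len lam (r - 1) \<longleftrightarrow>
        c = 1 \<and> 1 \<le> row_len lam (r - 1) \<or> c = 2 \<and> 2 \<le> row_len lam (r - 1)" by auto
      then show ?thesis
        using 4 len[of "r - 1"] col2[of "r - 1"] by (auto simp: mem_diagram_iff mem_boxes)
    qed (auto simp: mem_diagram_iff mem_boxes)
  qed
  then show "diagram lam = boxes (row_len lam 0) (row_len lam 1) (length lam - 2) (column2 lam - 2)"
    by auto
qed

lemma num_SVT_eq_walks: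
  assumes "is_partition lam" "partition_rank lam < 3"
  shows "num_SVT lam N = walks N (row_len lam 0) (row_len lam 1) (length lam - 2) (column2 lam - 2)"
  using card_svt_on_boxes[OF diagram_eq_boxes(1)[OF assms]] diagram_eq_boxes(2)[OF assms]
  by (simp add: num_SVT_def SVT_eq_svt_on)

lemma row_len_0_le_num_boxes: "row_len lam 0 \<le> num_boxes lam"
proof -
  have "card ({1::nat} \<times> {1..row_len lam 0}) \<le> num_boxes lam"
    unfolding num_boxes_def by (rule card_mono[OF finite_diagram]) (auto simp: mem_diagram_iff)
  then show ?thesis by simp
qed

lemma length_le_num_boxes:
  assumes "is_partition lam"
  shows "length lam \<le> num_boxes lam"
proof -
  have "1 \<le> lam ! (r - 1)" if "r \<in> {1..length lam}" for r
    using assms that by (auto simp: is_partition_def Suc_le_eq)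
  then have "card ({1..length lam} \<times> {1::nat}) \<le> num_boxes lam"
    unfolding num_boxes_def by (intro card_mono[OF finite_diagram]) (auto simp: diagram_def)
  then show ?thesis by simp
qed

section \<open>Deterministic execution and running time\<close>

lemma run_0: "run 0 c = return_pmf c"
  by (simp add: run_def)

text \<open>\<open>run\<close> appends steps at the end, while program reasoning peels them off the
  front; an arbitrary start distribution makes the induction go through.\<close>

lemma funpow_bind_step: "((\<lambda>D. bind_pmf D step) ^^ n) D = bind_pmf D (run n)"
proof (induction n arbitrary: D)
  case 0
  show ?case by (simp add: run_0[abs_def] bind_return_pmf')
next
  case (Suc n)
  show ?case
    by (simp add: run_def[of "Suc n", abs_def] bind_assoc_pmf bind_return_pmf Suc)
qed

lemma run_Suc: "run (Suc n) c = bind_pmf (step c) (run n)"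
proof -
  have "run (Suc n) c = ((\<lambda>D. bind_pmf D step) ^^ n) (bind_pmf (return_pmf c) step)"
    unfolding run_def funpow_Suc_right by simp
  then show ?thesis by (simp add: funpow_bind_step bind_return_pmf)
qed

lemma run_add: "run (m + n) c = bind_pmf (run m c) (run n)"
proof (induction m arbitrary: c)
  case (Suc m)
  then have "run (m + n) = (\<lambda>c. bind_pmf (run m c) (run n))" by blast
  then show ?case by (simp add: run_Suc bind_assoc_pmf)
qed (simp add: run_0 bind_return_pmf)

lemma run_halted: "run n ([], s) = return_pmf ([], s)"
  by (induction n) (simp_all add: run_0 run_Suc bind_return_pmf)

text \<open>Deterministic execution: the outcome is a point mass. The continuation \<open>q\<close>
  makes runs composable, and \<open>n\<close> is only an upper bound, so that branches of unequal
  length can share it.\<close>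

definition terminates :: "program \<Rightarrow> state \<Rightarrow> nat \<Rightarrow> state \<Rightarrow> bool" where
  "terminates p s n s' \<longleftrightarrow> (\<exists>m\<le>n. \<forall>q. run m (p @ q, s) = return_pmf (q, s'))"

lemma terminates_mono: "terminates p s m s' \<Longrightarrow> m \<le> n \<Longrightarrow> terminates p s n s'"
  unfolding terminates_def using le_trans by blast

lemma terminates_Nil: "terminates [] s n s"
  unfolding terminates_def by (intro exI[of _ 0]) (simp add: run_0)

lemma terminates_append:
  assumes "terminates p s m s'" "terminates p' s' n s''"
  shows "terminates (p @ p') s (m + n) s''"
proof -
  obtain i j where "i \<le> m" "\<And>q. run i (p @ q, s) = return_pmf (q, s')"
    and "j \<le> n" "\<And>q. run j (p' @ q, s') = return_pmf (q, s'')"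
    using assms unfolding terminates_def by blast
  then show ?thesis
    unfolding terminates_def by (intro exI[of _ "i + j"]) (simp add: run_add bind_return_pmf)
qed

lemma terminates_step:
  assumes "\<And>q. step (i # q, s) = return_pmf (p @ q, s')" "terminates p s' n s''"
  shows "terminates [i] s (Suc n) s''"
proof -
  obtain m where "m \<le> n" "\<And>q. run m (p @ q, s') = return_pmf (q, s'')"
    using assms(2) unfolding terminates_def by blast
  then show ?thesis
    unfolding terminates_def
    by (intro exI[of _ "Suc m"]) (simp add: run_Suc assms(1) bind_return_pmf)
qed

lemma terminates_basic:
  "(\<And>q. step (i # q, s) = return_pmf (q, s')) \<Longrightarrow> terminates [i] s 1 s'"
  using terminates_step[of i s "[]" s' 0 s'] by (simp add: terminates_Nil)

lemma terminates_While_0: "reg s x = 0 \<Longrightarrow> terminates [WhileNZ x p] s 1 s"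
  by (rule terminates_basic) simp

lemma terminates_While_Suc:
  assumes "reg s x \<noteq> 0" "terminates p s m s'" "terminates [WhileNZ x p] s' n s''"
  shows "terminates [WhileNZ x p] s (Suc (m + n)) s''"
  by (rule terminates_step[OF _ terminates_append[OF assms(2,3)]]) (simp add: assms(1))

text \<open>\<open>f\<close> is a variant bounding the number of iterations. Each iteration pays for
  the body and its test; the final 1 is the failing test.\<close>

lemma terminates_While:
  assumes body: "\<And>s. I s \<Longrightarrow> reg s x \<noteq> 0 \<Longrightarrow> \<exists>s'. terminates p s n s' \<and> I s' \<and> f s' < f s"
  shows "I s \<Longrightarrow> \<exists>s'. terminates [WhileNZ x p] s (f s * Suc n + 1) s' \<and> I s' \<and> reg s' x = 0"
proof (induction "f s" arbitrary: s rule: less_induct)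
  case less
  show ?case
  proof (cases "reg s x = 0")
    case True
    then show ?thesis
      using less.prems terminates_mono[OF terminates_While_0] by (metis le_add2)
  next
    case False
    then obtain s' where s': "terminates p s n s'" "I s'" "f s' < f s"
      using body less.prems by blast
    then obtain s'' where s'': "terminates [WhileNZ x p] s' (f s' * Suc n + 1) s''" "I s''" "reg s'' x = 0"
      using less.hyps by blast
    have "Suc (n + (f s' * Suc n + 1)) = Suc (f s') * Suc n + 1" by simp
    also have "\<dots> \<le> f s * Suc n + 1"
      using s'(3) by (intro add_right_mono mult_le_mono1) simp
    finally show ?thesis
      using terminates_mono[OF terminates_While_Suc[OF False s'(1) s''(1)]] s'' by blast
  qed
qed

section \<open>Loop-free code as a function on states\<close>

fun loop_free :: "program \<Rightarrow> bool" where
  "loop_free [] \<longleftrightarrow> True"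
| "loop_free (IfNZ x p1 p2 # p) \<longleftrightarrow> loop_free p1 \<and> loop_free p2 \<and> loop_free p"
| "loop_free (WhileNZ x p1 # p) \<longleftrightarrow> False"
| "loop_free (Flip x # p) \<longleftrightarrow> False"
| "loop_free (i # p) \<longleftrightarrow> loop_free p"

text \<open>Lets the simplifier evaluate straight-line code. The clauses for \<open>Flip\<close> and
  \<open>WhileNZ\<close> do not describe the machine; \<open>loop_free\<close> excludes
  both.\<close>

fun exec :: "program \<Rightarrow> state \<Rightarrow> state" where
  "exec [] s = s"
| "exec (Const x k # p) s = exec p (set_reg x k s)"
| "exec (Add x y z # p) s = exec p (set_reg x (reg s y + reg s z) s)"
| "exec (Sub x y z # p) s = exec p (set_reg x (reg s y - reg s z) s)"
| "exec (Load x a y # p) s = exec p (set_reg x (arr s a (reg s y)) s)"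
| "exec (Store a y x # p) s = exec p (set_arr a (reg s y) (reg s x) s)"
| "exec (IfNZ x p1 p2 # p) s = exec p (if reg s x \<noteq> 0 then exec p1 s else exec p2 s)"
| "exec (Flip x # p) s = exec p s"
| "exec (WhileNZ x p1 # p) s = exec p s"

fun time :: "program \<Rightarrow> nat" where
  "time [] = 0"
| "time (IfNZ x p1 p2 # p) = Suc (max (time p1) (time p2) + time p)"
| "time (i # p) = Suc (time p)"

lemma terminates_Cons:
  assumes "\<And>q. step (i # q, s) = return_pmf (p' @ q, s')" "terminates p' s' m s''"
    "terminates p s'' n t"
  shows "terminates (i # p) s (Suc (m + n)) t"
  using terminates_append[OF terminates_step[OF assms(1,2)] assms(3)] by simp

lemma terminates_basic_Cons:
  assumes "\<And>q. step (i # q, s) = return_pmf (q, s')" "terminates p s' n s''"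
  shows "terminates (i # p) s (Suc n) s''"
  using terminates_Cons[of i s "[]" s' 0 s'] assms by (simp add: terminates_Nil)

lemma terminates_exec: "loop_free p \<Longrightarrow> terminates p s (time p) (exec p s)"
proof (induction p s rule: exec.induct)
  case (7 x p1 p2 p s)
  define p' where "p' = (if reg s x \<noteq> 0 then p1 else p2)"
  have "terminates p' s (time p') (exec p' s)"
    using 7 by (simp add: p'_def)
  then have "terminates p' s (max (time p1) (time p2)) (exec p' s)"
    by (rule terminates_mono) (simp add: p'_def)
  moreover have "step (IfNZ x p1 p2 # q, s) = return_pmf (p' @ q, s)" for q
    by (simp add: p'_def)
  moreover have "terminates p (exec p' s) (time p) (exec p (exec p' s))"
    using 7 by (cases "reg s x = 0") (simp_all add: p'_def)
  ultimately have "terminates (IfNZ x p1 p2 # p) s (Suc (max (time p1) (time p2) + time p))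
      (exec p (exec p' s))"
    by (intro terminates_Cons)
  then show ?case by (simp add: p'_def split: if_splits)
qed (simp_all add: terminates_Nil terminates_basic_Cons)

lemma loop_free_append [simp]: "loop_free (p @ q) \<longleftrightarrow> loop_free p \<and> loop_free q"
  by (induction p rule: loop_free.induct) auto

lemma exec_append [simp]: "exec (p @ q) s = exec q (exec p s)"
  by (induction p s rule: exec.induct) auto

lemma time_append [simp]: "time (p @ q) = time p + time q"
  by (induction p rule: time.induct) auto

lemma reg_set_reg [simp]: "reg (set_reg x v s) y = (if y = x then v else reg s y)"
  and arr_set_reg [simp]: "arr (set_reg x v s) = arr s"
  and reg_set_arr [simp]: "reg (set_arr a i v s) = reg s"
  and arr_set_arr [simp]: "arr (set_arr a i v s) = (arr s)(a := (arr s a)(i := v))"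
  by (simp_all add: set_reg_def set_arr_def)

section \<open>Subroutines with loops: multiplication and the second column\<close>

definition mult_prog :: "nat \<Rightarrow> nat \<Rightarrow> nat \<Rightarrow> program" where
  "mult_prog z x y = [Const z 0, Const 20 0, Add 20 20 y] @ [WhileNZ 20 [Add z z x, Sub 20 20 2]]"

text \<open>Repeated addition, with register 20 counting down. A round costs one test and two
  instructions, and the last test is the extra 1.\<close>

lemma terminates_mult_loop:
  assumes "reg s 2 = 1" "z \<noteq> x" "z \<notin> {2, 20}" "x \<noteq> 20"
  shows "\<exists>s'. terminates [WhileNZ 20 [Add z z x, Sub 20 20 2]] s (3 * reg s 20 + 1) s' \<and>
    reg s' z = reg s z + reg s x * reg s 20 \<and>
    (\<forall>u. u \<notin> {z, 20} \<longrightarrow> reg s' u = reg s u) \<and> arr s' = arr s"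
  using assms(1)
proof (induction "reg s 20" arbitrary: s)
  case 0
  then show ?case using terminates_While_0[of s 20] by (intro exI[of _ s]) simp
next
  case (Suc n)
  define s1 where "s1 = exec [Add z z x, Sub 20 20 2] s"
  have s1: "reg s1 20 = n" "reg s1 2 = 1" "reg s1 z = reg s z + reg s x" "reg s1 x = reg s x"
    "\<And>u. u \<notin> {z, 20} \<Longrightarrow> reg s1 u = reg s u" "arr s1 = arr s"
    using Suc.prems Suc.hyps(2) assms(2-4) by (auto simp: s1_def)
  from Suc.hyps(1)[OF s1(1)[symmetric] s1(2)] obtain s' where
    s': "terminates [WhileNZ 20 [Add z z x, Sub 20 20 2]] s1 (3 * n + 1) s'"
    "reg s' z = reg s z + reg s x + reg s x * n"
    "\<And>u. u \<notin> {z, 20} \<Longrightarrow> reg s' u = reg s1 u" "arr s' = arr s"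
    unfolding s1(1,3,4,6) by blast
  have "terminates [Add z z x, Sub 20 20 2] s 2 s1"
    using terminates_exec[of "[Add z z x, Sub 20 20 2]" s] by (simp add: s1_def numeral_2_eq_2)
  then have "terminates [WhileNZ 20 [Add z z x, Sub 20 20 2]] s (Suc (2 + (3 * n + 1))) s'"
    using s'(1) Suc.hyps(2) by (intro terminates_While_Suc) auto
  then have "terminates [WhileNZ 20 [Add z z x, Sub 20 20 2]] s (3 * reg s 20 + 1) s'"
    by (rule terminates_mono) (simp add: Suc.hyps(2)[symmetric])
    moreover have "reg s' z = reg s z + reg s x * reg s 20"
    using s'(2) Suc.hyps(2)[symmetric] by simp
  moreover have "reg s' u = reg s u" if "u \<notin> {z, 20}" for u
    using s'(3)[OF that] s1(5)[OF that] by (rule trans)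
  ultimately show ?case using s'(4) by (intro exI[of _ s'] conjI allI impI)
qed

lemma terminates_mult_prog:
  assumes "reg s 2 = 1" "z \<noteq> x" "z \<noteq> y" "z \<notin> {2, 20}" "x \<noteq> 20" "y \<noteq> 20"
  shows "\<exists>s'. terminates (mult_prog z x y) s (3 * reg s y + 4) s' \<and>
    reg s' z = reg s x * reg s y \<and>
    (\<forall>u. u \<notin> {z, 20} \<longrightarrow> reg s' u = reg s u) \<and> arr s' = arr s"
proof -
  define s1 where "s1 = exec [Const z 0, Const 20 0, Add 20 20 y] s"
  have s1: "reg s1 20 = reg s y" "reg s1 2 = 1" "reg s1 z = 0" "reg s1 x = reg s x"
    "\<And>u. u \<notin> {z, 20} \<Longrightarrow> reg s1 u = reg s u" "arr s1 = arr s"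
    using assms by (auto simp: s1_def)
  obtain s' where s': "terminates [WhileNZ 20 [Add z z x, Sub 20 20 2]] s1 (3 * reg s y + 1) s'"
    "reg s' z = reg s x * reg s y" "\<And>u. u \<notin> {z, 20} \<Longrightarrow> reg s' u = reg s1 u" "arr s' = arr s"
    using terminates_mult_loop[OF s1(2) assms(2,4,5)] unfolding s1(1,3,4,6) by auto
  have "terminates [Const z 0, Const 20 0, Add 20 20 y] s 3 s1"
    using terminates_exec[of "[Const z 0, Const 20 0, Add 20 20 y]" s]
    by (simp add: s1_def numeral_3_eq_3)
  from terminates_append[OF this s'(1)] have "terminates (mult_prog z x y) s (3 * reg s y + 4) s'"
    unfolding mult_prog_def by (rule terminates_mono) simp
  moreover have "reg s' u = reg s u" if "u \<notin> {z, 20}" for u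
    using s'(3)[OF that] s1(5)[OF that] by (rule trans)
  ultimately show ?thesis using s'(2,4) by (intro exI[of _ s'] conjI allI impI)
qed

text \<open>Rows are read from the last to the first. Truncated subtraction of 1 leaves a nonzero
  number exactly for rows of length at least 2. Register 0 is consumed as the counter.\<close>

definition column_loop :: program where
  "column_loop =
     [WhileNZ 0 [Sub 0 0 2, Load 18 0 0, Sub 18 18 2, IfNZ 18 [Add 7 7 2] []]]"

lemma terminates_column_loop:
  assumes "reg s 2 = 1" "reg s 0 \<le> length lam" "\<And>i. i < length lam \<Longrightarrow> arr s 0 i = lam ! i"
  shows "\<exists>s'. terminates column_loop s (6 * reg s 0 + 1) s' \<and>
    reg s' 7 = reg s 7 + column2 (take (reg s 0) lam) \<and>
    (\<forall>u. u \<notin> {0, 7, 18} \<longrightarrow> reg s' u = reg s u) \<and> arr s' = arr s"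
  using assms
proof (induction "reg s 0" arbitrary: s)
  case 0
  then show ?case
    using terminates_While_0[of s 0]
    by (intro exI[of _ s]) (simp add: column_loop_def column2_def)
next
  case (Suc n)
  let ?p = "[Sub 0 0 2, Load 18 0 0, Sub 18 18 2, IfNZ 18 [Add 7 7 2] []]"
  define s1 where "s1 = exec ?p s"
  have n: "n < length lam" "reg s 0 = Suc n" using Suc by auto
  have s1: "reg s1 0 = n" "reg s1 2 = 1" "reg s1 7 = reg s 7 + of_bool (2 \<le> lam ! n)"
    "\<And>u. u \<notin> {0, 7, 18} \<Longrightarrow> reg s1 u = reg s u" "arr s1 = arr s"
    using Suc.prems n by (auto simp: s1_def)
  have "\<exists>s'. terminates column_loop s1 (6 * reg s1 0 + 1) s' \<and>
    reg s' 7 = reg s1 7 + column2 (take (reg s1 0) lam) \<and>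
    (\<forall>u. u \<notin> {0, 7, 18} \<longrightarrow> reg s' u = reg s1 u) \<and> arr s' = arr s1"
    using Suc.prems(3) n(1) s1 by (intro Suc.hyps(1)) auto
  then obtain s' where s': "terminates column_loop s1 (6 * n + 1) s'"
    "reg s' 7 = reg s 7 + of_bool (2 \<le> lam ! n) + column2 (take n lam)"
    "\<And>u. u \<notin> {0, 7, 18} \<Longrightarrow> reg s' u = reg s1 u" "arr s' = arr s"
    unfolding s1(1,3,5) by blast
  have "terminates ?p s 5 s1"
    using terminates_exec[of ?p s] by (simp add: s1_def eval_nat_numeral)
  then have "terminates column_loop s (Suc (5 + (6 * n + 1))) s'"
    using s'(1) n unfolding column_loop_def by (intro terminates_While_Suc) auto
  then have "terminates column_loop s (6 * reg s 0 + 1) s'"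
    by (rule terminates_mono) (simp add: n)
  moreover have "reg s' 7 = reg s 7 + column2 (take (reg s 0) lam)"
    using s'(2) n by (simp add: column2_def take_Suc_conv_app_nth)
  moreover have "reg s' u = reg s u" if "u \<notin> {0, 7, 18}" for u
    using s'(3)[OF that] s1(4)[OF that] by (rule trans)
  ultimately show ?case using s'(4) by (intro exI[of _ s'] conjI allI impI)
qed

section \<open>The dynamic program\<close>

definition index :: "nat \<Rightarrow> nat \<Rightarrow> nat \<Rightarrow> nat \<Rightarrow> nat \<Rightarrow> nat \<Rightarrow> nat" where
  "index D v p q s t = (((v * D + p) * D + q) * D + s) * D + t"

text \<open>Describing the table by address lets the invariant speak of all positions below the
  current one.\<close>

definition flat_walks :: "nat \<Rightarrow> nat \<Rightarrow> nat" where
  "flat_walks D i = walks (i div D div D div D div D)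
     (i div D div D div D mod D) (i div D div D mod D) (i div D mod D) (i mod D)"

lemma flat_walks_index:
  "p < D \<Longrightarrow> q < D \<Longrightarrow> s < D \<Longrightarrow> t < D \<Longrightarrow> flat_walks D (index D v p q s t) = walks v p q s t"
  by (simp add: flat_walks_def index_def)

text \<open>Layer \<open>v\<close> ends before layer \<open>Suc v\<close> starts, so everything a
  cell depends on is already present.\<close>

lemma index_less_next_layer:
  assumes "p < D" "q < D" "s < D" "t < D"
  shows "index D v p q s t < index D (Suc v) 0 0 0 0"
proof -
  have *: "a * D + d < b * D" if "a < b" "d < D" for a b d
  proof -
    have "a * D + d < Suc a * D" using that by simp
    also have "\<dots> \<le> b * D" using that by (intro mult_le_mono1) simp
    finally show ?thesis .
  qed
  have "v * D + p < Suc v * D" using * assms by blast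
  from *[OF *[OF *[OF this assms(2)] assms(3)] assms(4)]
  show ?thesis by (simp only: index_def add_0_right)
qed

text \<open>
  With \<open>D = N + 1\<close>, the value \<open>walks v p q s t\<close> is stored in array 3 at the position whose base-\<open>D\<close>
  digits are \<open>v, p, q, s, t\<close>. Registers 2 and 17 hold the constants 1 and 2; registers 3, 8, 9
  and 10 hold the powers \<open>D, \<dots>, D\<^sup>4\<close>, which are the offsets of the neighbours in the table. Registers
  14, 13, 12 and 11 hold \<open>p, q, s, t\<close>, register 16 the current position, register 15 the number
  of layers \<open>v \<le> N\<close> that are not yet complete, and register 21 the position of the wanted entry
  relative to its layer.
\<close>

definition gather :: "nat \<Rightarrow> nat \<Rightarrow> program" where
  "gather w d = [IfNZ w [Sub 26 22 d, Load 26 3 26, Add 24 24 26, Add 24 24 23] []]"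

lemma exec_gather [simp]:
  "x \<noteq> 26 \<Longrightarrow> reg (exec (gather w d) s) x =
    (if x = 24 then reg s 24 +
       (if reg s w \<noteq> 0 then arr s 3 (reg s 22 - reg s d) + reg s 23 else 0) else reg s x)"
  "arr (exec (gather w d) s) = arr s"
  by (simp_all add: gather_def)

text \<open>Register 22 addresses the same quadruple one layer earlier, 23 holds its entry, 24 the
  growing sum, 25 and 27 the guards. A guard \<open>x < y\<close> is tested as the truncated
  difference \<open>y - x\<close> being nonzero.\<close>

definition fill_cell :: program where
  "fill_cell =
     [Sub 22 16 10, Load 23 3 22, Const 24 0] @
     [Sub 25 14 13] @ gather 25 9 @
     [Sub 25 2 12, Sub 27 2 11, Add 25 25 27, Sub 25 17 25, Sub 25 13 25] @ gather 25 8 @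
     [Sub 25 12 11] @ gather 25 3 @
     gather 11 2 @
     [Store 3 16 24, Add 16 16 2]"

lemma exec_fill_cell:
  assumes "reg s 2 = 1" "reg s 17 = 2"
  defines "s' \<equiv> exec fill_cell s" and "A \<equiv> arr s 3" and "b \<equiv> reg s 16 - reg s 10"
  shows "u \<notin> {16, 22, 23, 24, 25, 26, 27} \<Longrightarrow> reg s' u = reg s u"
    and "reg s' 16 = reg s 16 + 1"
    and "arr s' 3 = A(reg s 16 :=
      (if reg s 13 < reg s 14 then A (b - reg s 9) + A b else 0) +
      (if of_bool (0 < reg s 12) + of_bool (0 < reg s 11) < reg s 13
       then A (b - reg s 8) + A b else 0) +
      (if reg s 11 < reg s 12 then A (b - reg s 3) + A b else 0) +
      (if 0 < reg s 11 then A (b - 1) + A b else 0))"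
proof -
  show "u \<notin> {16, 22, 23, 24, 25, 26, 27} \<Longrightarrow> reg s' u = reg s u"
    by (simp add: s'_def fill_cell_def)
  show "reg s' 16 = reg s 16 + 1"
    using assms(1) by (simp add: s'_def fill_cell_def)
  \<comment> \<open>\<open>1 - x\<close> detects \<open>x = 0\<close>, so subtracting both from 2
    counts the nonempty column parts.\<close>
  have w: "2 - (Suc 0 - x + (Suc 0 - y)) = of_bool (0 < x) + of_bool (0 < y)" for x y :: nat
    by (cases "x = 0"; cases "y = 0") auto
  show "arr s' 3 = A(reg s 16 :=
      (if reg s 13 < reg s 14 then A (b - reg s 9) + A b else 0) +
      (if of_bool (0 < reg s 12) + of_bool (0 < reg s 11) < reg s 13
       then A (b - reg s 8) + A b else 0) +
      (if reg s 11 < reg s 12 then A (b - reg s 3) + A b else 0) +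
      (if 0 < reg s 11 then A (b - 1) + A b else 0))"
    using assms(1,2) by (simp add: s'_def A_def b_def fill_cell_def w)
qed

text \<open>Increments the base-\<open>D\<close> digits with carry; \<open>D - x\<close> becomes 0
  exactly when a digit \<open>x\<close> has reached \<open>D\<close>. A carry out of the leading
  digit completes a layer.\<close>

definition odometer :: program where
  "odometer =
     [Add 11 11 2, Sub 25 3 11, IfNZ 25 []
       [Const 11 0, Add 12 12 2, Sub 25 3 12, IfNZ 25 []
         [Const 12 0, Add 13 13 2, Sub 25 3 13, IfNZ 25 []
           [Const 13 0, Add 14 14 2, Sub 25 3 14, IfNZ 25 []
             [Const 14 0, Sub 15 15 2]]]]]"

text \<open>No register holds the layer number \<open>v\<close>; it is known only through its
  constant sum with register 15. The cases count how many digits roll over.\<close>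

lemma exec_odometer:
  assumes "reg s 2 = 1" "reg s 3 = D" "reg s 15 \<noteq> 0"
    "reg s 14 < D" "reg s 13 < D" "reg s 12 < D" "reg s 11 < D"
  defines "s' \<equiv> exec odometer s"
  shows "arr s' = arr s" and "u \<notin> {11, 12, 13, 14, 15, 25} \<Longrightarrow> reg s' u = reg s u"
    and "\<exists>v'. v' + reg s' 15 = v + reg s 15 \<and> v \<le> v' \<and>
      reg s' 14 < D \<and> reg s' 13 < D \<and> reg s' 12 < D \<and> reg s' 11 < D \<and>
      index D v' (reg s' 14) (reg s' 13) (reg s' 12) (reg s' 11) =
      Suc (index D v (reg s 14) (reg s 13) (reg s 12) (reg s 11))"
proof -
  show "arr s' = arr s" "u \<notin> {11, 12, 13, 14, 15, 25} \<Longrightarrow> reg s' u = reg s u"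
    by (simp_all add: s'_def odometer_def)
  obtain d where d: "D = Suc d" using assms(7) by (cases D) auto
  consider
      "Suc (reg s 11) < D"
    | "Suc (reg s 11) = D" "Suc (reg s 12) < D"
    | "Suc (reg s 11) = D" "Suc (reg s 12) = D" "Suc (reg s 13) < D"
    | "Suc (reg s 11) = D" "Suc (reg s 12) = D" "Suc (reg s 13) = D" "Suc (reg s 14) < D"
    | "Suc (reg s 11) = D" "Suc (reg s 12) = D" "Suc (reg s 13) = D" "Suc (reg s 14) = D"
    using assms(4-7) by linarith
  then show "\<exists>v'. v' + reg s' 15 = v + reg s 15 \<and> v \<le> v' \<and>
      reg s' 14 < D \<and> reg s' 13 < D \<and> reg s' 12 < D \<and> reg s' 11 < D \<and>
      index D v' (reg s' 14) (reg s' 13) (reg s' 12) (reg s' 11) =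
      Suc (index D v (reg s 14) (reg s 13) (reg s 12) (reg s 11))"
  proof cases
    case 1
    then show ?thesis
      using assms(1-7) d by (intro exI[of _ v]) (simp add: s'_def odometer_def index_def)
  next
    case 2
    then show ?thesis
      using assms(1-7) d by (intro exI[of _ v]) (simp add: s'_def odometer_def index_def algebra_simps)
  next
    case 3
    then show ?thesis
      using assms(1-7) d by (intro exI[of _ v]) (simp add: s'_def odometer_def index_def algebra_simps)
  next
    case 4
    then show ?thesis
      using assms(1-7) d by (intro exI[of _ v]) (simp add: s'_def odometer_def index_def algebra_simps)
  next
    case 5
    then show ?thesis
      using assms(1-7) d by (intro exI[of _ "Suc v"]) (simp add: s'_def odometer_def index_def algebra_simps)
  qed
qed

section \<open>Address arithmetic and the loop that fills the table\<close>

lemma index_minus: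
  "index D (Suc v) p q s t - D * D * D * D = index D v p q s t"
  "0 < p \<Longrightarrow> index D v p q s t - D * D * D = index D v (p - 1) q s t"
  "0 < q \<Longrightarrow> index D v p q s t - D * D = index D v p (q - 1) s t"
  "0 < s \<Longrightarrow> index D v p q s t - D = index D v p q (s - 1) t"
  "0 < t \<Longrightarrow> index D v p q s t - 1 = index D v p q s (t - 1)"
proof -
  show "index D (Suc v) p q s t - D * D * D * D = index D v p q s t"
    by (simp add: index_def algebra_simps)
  show "0 < p \<Longrightarrow> index D v p q s t - D * D * D = index D v (p - 1) q s t"
    by (cases p) (simp_all add: index_def algebra_simps)
  show "0 < q \<Longrightarrow> index D v p q s t - D * D = index D v p (q - 1) s t"
    by (cases q) (simp_all add: index_def algebra_simps)
  show "0 < s \<Longrightarrow> index D v p q s t - D = index D v p q (s - 1) t"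
    by (cases s) (simp_all add: index_def algebra_simps)
  show "0 < t \<Longrightarrow> index D v p q s t - 1 = index D v p q s (t - 1)"
    by (cases t) (simp_all add: index_def)
qed

lemma index_last_layer: "index D D 0 0 0 0 = D ^ 5"
  by (simp add: index_def eval_nat_numeral mult.assoc)

lemma index_layer_le: "index D v 0 0 0 0 \<le> index D v p q s t"
  by (simp add: index_def algebra_simps)

text \<open>Layer 0 is filled beforehand, hence \<open>v\<close> is at least 1. Once register 15 is
  0, \<open>v = D\<close> and layers 0 to \<open>N\<close> are complete; the upper bound on register
  16 then pins it to the end of the table. \<open>k\<close> carries the wanted address through the
  loop.\<close>

definition table_inv :: "nat \<Rightarrow> nat \<Rightarrow> state \<Rightarrow> bool" where
  "table_inv N k st \<longleftrightarrow> (let D = Suc N in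
     reg st 2 = 1 \<and> reg st 17 = 2 \<and> reg st 3 = D \<and> reg st 8 = D * D \<and>
     reg st 9 = D * D * D \<and> reg st 10 = D * D * D * D \<and> reg st 21 = k \<and>
     reg st 14 < D \<and> reg st 13 < D \<and> reg st 12 < D \<and> reg st 11 < D \<and>
     reg st 16 \<le> index D D 0 0 0 0 \<and>
     (\<forall>i < reg st 16. arr st 3 i = flat_walks D i) \<and>
     (\<exists>v\<ge>1. v + reg st 15 = D \<and>
       reg st 16 = index D v (reg st 14) (reg st 13) (reg st 12) (reg st 11)))"

lemma table_inv_step:
  assumes inv: "table_inv N k st" and "reg st 15 \<noteq> 0"
  defines "st' \<equiv> exec (fill_cell @ odometer) st"
  shows "table_inv N k st'" and "reg st' 16 = Suc (reg st 16)"
    and "reg st 16 < index (Suc N) (Suc N) 0 0 0 0"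
proof -
  define D where "D = Suc N"
  define p q s t where "p = reg st 14" and "q = reg st 13" and "s = reg st 12" and "t = reg st 11"
  define A where "A = arr st 3"
  have D: "reg st 2 = 1" "reg st 17 = 2" "reg st 3 = D" "reg st 8 = D * D"
    "reg st 9 = D * D * D" "reg st 10 = D * D * D * D" "reg st 21 = k"
    and digits: "p < D" "q < D" "s < D" "t < D"
    and A: "\<And>i. i < reg st 16 \<Longrightarrow> A i = flat_walks D i"
    using inv unfolding table_inv_def Let_def D_def p_def q_def s_def t_def A_def by auto
  obtain v where v: "v + 1 + reg st 15 = D" "reg st 16 = index D (Suc v) p q s t"
    using inv unfolding table_inv_def Let_def D_def p_def q_def s_def t_def
    by (metis Suc_eq_plus1 Suc_le_D One_nat_def)
  \<comment> \<open>All neighbours lie in layer \<open>v\<close>, which is complete. This covers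
    quadruples that are no shapes too, as the recursion of \<open>walks\<close> is computed
    literally for all digits.\<close>
  have old: "A (index D v p' q' s' t') = walks v p' q' s' t'"
    if "p' < D" "q' < D" "s' < D" "t' < D" for p' q' s' t'
  proof -
    have "index D v p' q' s' t' < index D (Suc v) 0 0 0 0"
      using that by (rule index_less_next_layer)
    also have "\<dots> \<le> reg st 16" unfolding v by (rule index_layer_le)
    finally show ?thesis using A that by (simp add: flat_walks_index)
  qed
  define st1 where "st1 = exec fill_cell st"
  note fill = exec_fill_cell[OF D(1,2), folded st1_def p_def q_def s_def t_def A_def]
  have "arr st1 3 = A(reg st 16 := walks (Suc v) p q s t)"
    using digits unfolding fill(3) D v index_minus(1)
    by (simp add: index_minus old less_imp_diff_less del: One_nat_def)
  then have arr1: "arr st1 3 i = flat_walks D i" if "i < reg st1 16" for i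
    using that A digits fill(2) by (cases "i = reg st 16") (auto simp: v flat_walks_index)
  have st': "st' = exec odometer st1" by (simp add: st'_def st1_def)
  have regs1: "reg st1 2 = 1" "reg st1 3 = D" "reg st1 15 \<noteq> 0"
    "reg st1 14 = p" "reg st1 13 = q" "reg st1 12 = s" "reg st1 11 = t"
    using D assms(2) by (simp_all add: fill(1) p_def q_def s_def t_def)
  have digits1: "reg st1 14 < D" "reg st1 13 < D" "reg st1 12 < D" "reg st1 11 < D"
    using regs1 digits by simp_all
  note odo = exec_odometer[OF regs1(1,2,3) digits1, folded st']
  have other: "reg st' u = reg st u" if "u \<in> {2, 3, 8, 9, 10, 17, 21}" for u
    using that odo(2)[of u] fill(1)[of u] by auto
  show r16: "reg st' 16 = Suc (reg st 16)"
    using odo(2)[of 16] fill(2) by simp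
  \<comment> \<open>Register 15 is nonzero, so the current layer \<open>Suc v\<close> is below
    \<open>D\<close> and ends within the table.\<close>
  have "reg st 16 < index D (Suc (Suc v)) 0 0 0 0"
    unfolding v using digits by (rule index_less_next_layer)
  also have "\<dots> \<le> index D D 0 0 0 0"
  proof -
    have "Suc (Suc v) \<le> D" using v(1) assms(2) by simp
    then show ?thesis unfolding index_def add_0_right by (intro mult_le_mono1)
  qed
  finally have less: "reg st 16 < index D D 0 0 0 0" .
  then show "reg st 16 < index (Suc N) (Suc N) 0 0 0 0" by (simp only: D_def)
  have "reg st1 15 = reg st 15" using fill(1)[of 15] by simp
  obtain v' where v': "v' + reg st' 15 = Suc v + reg st1 15" "Suc v \<le> v'"
    "reg st' 14 < D" "reg st' 13 < D" "reg st' 12 < D" "reg st' 11 < D"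
    "index D v' (reg st' 14) (reg st' 13) (reg st' 12) (reg st' 11) =
      Suc (index D (Suc v) (reg st1 14) (reg st1 13) (reg st1 12) (reg st1 11))"
    using odo(3)[of "Suc v"] by blast
  have index: "reg st' 16 = index D v' (reg st' 14) (reg st' 13) (reg st' 12) (reg st' 11)"
    unfolding v'(7) regs1 r16 v(2) ..
  have "v' + reg st' 15 = D" using v'(1) v(1) \<open>reg st1 15 = reg st 15\<close> by simp
  have "arr st' 3 i = flat_walks D i" if "i < reg st' 16" for i
    using arr1[of i] that fill(2) by (simp add: odo(1) r16)
  moreover have "\<exists>v\<ge>1. v + reg st' 15 = D \<and>
      reg st' 16 = index D v (reg st' 14) (reg st' 13) (reg st' 12) (reg st' 11)"
    using v'(2) index \<open>v' + reg st' 15 = D\<close> by (intro exI[of _ v']) simp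
  ultimately show "table_inv N k st'"
    unfolding table_inv_def Let_def D_def[symmetric]
    using v'(3-6) less by (intro conjI) (simp_all only: other D r16 insert_iff Suc_le_eq simp_thms, blast)
qed

definition table_loop :: program where
  "table_loop = [WhileNZ 15 (fill_cell @ odometer)]"

lemma terminates_table_loop:
  assumes "table_inv N k st"
  shows "\<exists>st'. terminates table_loop st (100 * Suc N ^ 5 + 1) st' \<and>
    table_inv N k st' \<and> reg st' 15 = 0"
proof -
  define f where "f st = index (Suc N) (Suc N) 0 0 0 0 - reg st 16" for st :: state
  \<comment> \<open>A round bound, chosen so that an iteration with its test costs at most
    100.\<close>
  have time: "time (fill_cell @ odometer) \<le> 99"
    by (simp add: fill_cell_def odometer_def gather_def)
  have "loop_free (fill_cell @ odometer)"
    by (simp add: fill_cell_def odometer_def gather_def)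
  then have "terminates (fill_cell @ odometer) st 99 (exec (fill_cell @ odometer) st)" for st
    using terminates_exec terminates_mono time by blast
  then have body: "\<exists>st'. terminates (fill_cell @ odometer) st 99 st' \<and> table_inv N k st' \<and> f st' < f st"
    if "table_inv N k st" "reg st 15 \<noteq> 0" for st
    using table_inv_step[OF that] unfolding f_def
    by (intro exI[of _ "exec (fill_cell @ odometer) st"]) (simp del: exec_append)
  obtain st' where "terminates table_loop st (f st * Suc 99 + 1) st'"
    and st': "table_inv N k st'" "reg st' 15 = 0"
    using terminates_While[where I = "table_inv N k", OF body assms] unfolding table_loop_def by blast
  moreover have "f st \<le> Suc N ^ 5"
    unfolding f_def index_last_layer by (rule diff_le_self)
  then have "f st * Suc 99 + 1 \<le> 100 * Suc N ^ 5 + 1" by simp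
  ultimately have "terminates table_loop st (100 * Suc N ^ 5 + 1) st'"
    using terminates_mono by blast
  then show ?thesis using st' by blast
qed

section \<open>Initialisation and read-out\<close>

definition prepare :: program where
  "prepare =
     [Const 2 1, Const 17 2, Add 3 1 2, Load 4 0 22, Load 5 0 2, Sub 6 0 17] @
     column_loop @ [Sub 7 7 17] @
     mult_prog 8 3 3 @ mult_prog 9 8 3 @ mult_prog 10 9 3 @
     mult_prog 18 4 3 @ [Add 18 18 5] @ mult_prog 19 18 3 @ [Add 19 19 6] @
     mult_prog 21 19 3 @ [Add 21 21 7, Store 3 11 2, Add 15 1 11, Add 16 10 11]"

text \<open>Only the empty quadruple has a walk of length 0. As array 3 starts out as 0, a single
  \<open>Store\<close> initialises layer 0.\<close>

lemma flat_walks_layer_0: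
  assumes "i < D * D * D * D"
  shows "flat_walks D i = (if i = 0 then 1 else 0)"
proof -
  have top: "i div D div D div D div D = 0"
    using assms by (simp flip: div_mult2_eq add: mult.assoc)
  have small: "x mod D = x" if "x div D = 0" for x
    using div_mult_mod_eq[of x D] that by simp
  have zero: "x = 0" if "x mod D = 0" "x div D = 0" for x
    using div_mult_mod_eq[of x D] that by simp
  have c: "i div D div D div D mod D = i div D div D div D"
    by (rule small) (rule top)
  have "i = 0" if "i mod D = 0" "i div D mod D = 0" "i div D div D mod D = 0" "i div D div D div D = 0"
    using zero[OF that(1) zero[OF that(2) zero[OF that(3,4)]]] .
  then show ?thesis
    unfolding flat_walks_def top c by auto
qed

text \<open>Registers 22 and 11 still hold their initial 0: the former addresses the first row, the
  latter serves for copying. Of the six multiplications by \<open>D\<close>, three yield its powers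
  and three evaluate the wanted address by Horner's rule.\<close>

lemma terminates_prepare:
  fixes lam :: "nat list"
  defines "P \<equiv> row_len lam 0" and "Q \<equiv> row_len lam 1"
    and "S \<equiv> length lam - 2" and "T \<equiv> column2 lam - 2"
  shows "\<exists>st. terminates prepare (input_state lam N \<epsilon> \<delta>) (6 * length lam + 18 * Suc N + 40) st \<and>
    table_inv N (index (Suc N) 0 P Q S T) st"
proof -
  define D where "D = Suc N"
  define s0 where "s0 = input_state lam N \<epsilon> \<delta>"
  let ?p1 = "[Const 2 1, Const 17 2, Add 3 1 2, Load 4 0 22, Load 5 0 2, Sub 6 0 17]"
  define s1 where "s1 = exec ?p1 s0"
  have t1: "terminates ?p1 s0 6 s1"
    using terminates_exec[of ?p1 s0] by (simp add: s1_def eval_nat_numeral)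
  have s1: "reg s1 0 = length lam" "reg s1 1 = N" "reg s1 2 = 1" "reg s1 17 = 2" "reg s1 3 = D"
    "reg s1 4 = P" "reg s1 5 = Q" "reg s1 6 = S" "reg s1 7 = 0" "reg s1 11 = 0" "reg s1 12 = 0"
    "reg s1 13 = 0" "reg s1 14 = 0"
    "\<And>i. i < length lam \<Longrightarrow> arr s1 0 i = lam ! i" "arr s1 3 = (\<lambda>_. 0)"
    by (simp_all add: s1_def s0_def input_state_def D_def P_def Q_def S_def row_len_def)
  obtain s2 where t2: "terminates column_loop s1 (6 * length lam + 1) s2"
    and s2: "reg s2 7 = column2 lam" "\<And>u. u \<notin> {0, 7, 18} \<Longrightarrow> reg s2 u = reg s1 u" "arr s2 = arr s1"
    using terminates_column_loop[of s1 lam] s1 by auto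
  define s3 where "s3 = exec [Sub 7 7 17] s2"
  have t3: "terminates [Sub 7 7 17] s2 1 s3"
    using terminates_exec[of "[Sub 7 7 17]" s2] by (simp add: s3_def)
  have s3: "reg s3 7 = T" "\<And>u. u \<notin> {0, 7, 18} \<Longrightarrow> reg s3 u = reg s1 u" "arr s3 = arr s1"
    using s1 s2 by (auto simp: s3_def T_def)
  obtain s4 where t4: "terminates (mult_prog 8 3 3) s3 (3 * D + 4) s4"
    and s4: "reg s4 8 = D * D" "\<And>u. u \<notin> {8, 20} \<Longrightarrow> reg s4 u = reg s3 u" "arr s4 = arr s3"
    using terminates_mult_prog[of s3 8 3 3] by (auto simp: s3 s1)
  obtain s5 where t5: "terminates (mult_prog 9 8 3) s4 (3 * D + 4) s5"
    and s5: "reg s5 9 = D * D * D" "\<And>u. u \<notin> {9, 20} \<Longrightarrow> reg s5 u = reg s4 u" "arr s5 = arr s4"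
    using terminates_mult_prog[of s4 9 8 3] by (auto simp: s4 s3 s1)
  obtain s6 where t6: "terminates (mult_prog 10 9 3) s5 (3 * D + 4) s6"
    and s6: "reg s6 10 = D * D * D * D" "\<And>u. u \<notin> {10, 20} \<Longrightarrow> reg s6 u = reg s5 u" "arr s6 = arr s5"
    using terminates_mult_prog[of s5 10 9 3] by (auto simp: s5 s4 s3 s1)
  obtain s7 where t7: "terminates (mult_prog 18 4 3) s6 (3 * D + 4) s7"
    and s7: "reg s7 18 = P * D" "\<And>u. u \<notin> {18, 20} \<Longrightarrow> reg s7 u = reg s6 u" "arr s7 = arr s6"
    using terminates_mult_prog[of s6 18 4 3] by (auto simp: s6 s5 s4 s3 s1)
  define s8 where "s8 = exec [Add 18 18 5] s7"
  have t8: "terminates [Add 18 18 5] s7 1 s8"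
    using terminates_exec[of "[Add 18 18 5]" s7] by (simp add: s8_def)
  have s8: "reg s8 18 = P * D + Q" "\<And>u. u \<notin> {18, 20} \<Longrightarrow> reg s8 u = reg s6 u" "arr s8 = arr s6"
    by (auto simp: s8_def s7 s6 s5 s4 s3 s1)
  obtain s9 where t9: "terminates (mult_prog 19 18 3) s8 (3 * D + 4) s9"
    and s9: "reg s9 19 = (P * D + Q) * D" "\<And>u. u \<notin> {19, 20} \<Longrightarrow> reg s9 u = reg s8 u" "arr s9 = arr s8"
    using terminates_mult_prog[of s8 19 18 3] by (auto simp: s8 s6 s5 s4 s3 s1)
  define s10 where "s10 = exec [Add 19 19 6] s9"
  have t10: "terminates [Add 19 19 6] s9 1 s10"
    using terminates_exec[of "[Add 19 19 6]" s9] by (simp add: s10_def)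
  have s10: "reg s10 19 = (P * D + Q) * D + S" "\<And>u. u \<notin> {19, 20} \<Longrightarrow> reg s10 u = reg s8 u"
    "arr s10 = arr s8"
    by (auto simp: s10_def s9 s8 s6 s5 s4 s3 s1)
  obtain s11 where t11: "terminates (mult_prog 21 19 3) s10 (3 * D + 4) s11"
    and s11: "reg s11 21 = ((P * D + Q) * D + S) * D" "\<And>u. u \<notin> {21, 20} \<Longrightarrow> reg s11 u = reg s10 u"
      "arr s11 = arr s10"
    using terminates_mult_prog[of s10 21 19 3] by (auto simp: s10 s8 s6 s5 s4 s3 s1)
  let ?p2 = "[Add 21 21 7, Store 3 11 2, Add 15 1 11, Add 16 10 11]"
  define s12 where "s12 = exec ?p2 s11"
  have t12: "terminates ?p2 s11 4 s12"
    using terminates_exec[of ?p2 s11] by (simp add: s12_def eval_nat_numeral)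
  note regs = s11 s10 s8 s6 s5 s4 s3 s1
  have s12: "reg s12 2 = 1" "reg s12 17 = 2" "reg s12 3 = D" "reg s12 8 = D * D"
    "reg s12 9 = D * D * D" "reg s12 10 = D * D * D * D"
    "reg s12 21 = ((P * D + Q) * D + S) * D + T"
    "reg s12 11 = 0" "reg s12 12 = 0" "reg s12 13 = 0" "reg s12 14 = 0"
    "reg s12 15 = N" "reg s12 16 = D * D * D * D" "arr s12 3 = (\<lambda>_. 0)(0 := 1)"
    by (simp_all add: s12_def regs del: One_nat_def)
  have "terminates prepare s0 (6 * length lam + 18 * D + 40) s12"
    unfolding prepare_def
    by (rule terminates_mono[OF terminates_append[OF t1 terminates_append[OF t2
          terminates_append[OF t3 terminates_append[OF t4 terminates_append[OF t5
          terminates_append[OF t6 terminates_append[OF t7 terminates_append[OF t8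
          terminates_append[OF t9 terminates_append[OF t10 terminates_append[OF t11 t12]]]]]]]]]]]])
      simp
  moreover have "table_inv N (index (Suc N) 0 P Q S T) s12"
    unfolding table_inv_def Let_def D_def[symmetric]
  proof (intro conjI)
    show "\<forall>i<reg s12 16. arr s12 3 i = flat_walks D i"
      by (simp add: s12 flat_walks_layer_0)
    show "\<exists>v\<ge>1. v + reg s12 15 = D \<and>
        reg s12 16 = index D v (reg s12 14) (reg s12 13) (reg s12 12) (reg s12 11)"
      by (intro exI[of _ 1]) (simp add: s12 index_def D_def)
    have "1 \<le> D" by (simp add: D_def)
    then show "reg s12 16 \<le> index D D 0 0 0 0" by (simp add: s12 index_def)
  qed (simp_all add: s12 index_def, simp_all add: D_def)
  ultimately show ?thesis unfolding s0_def D_def by blast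
qed

definition svt_program :: program where
  "svt_program = prepare @ table_loop @
     [Sub 22 16 10, Add 22 22 21, Load 0 3 22, Const 1 1]"

lemma terminates_svt_program:
  assumes lam: "is_partition lam" "partition_rank lam < 3" and le: "num_boxes lam \<le> N"
  shows "\<exists>st. terminates svt_program (input_state lam N \<epsilon> \<delta>) (200 * Suc N ^ 5) st \<and>
    reg st 0 = num_SVT lam N \<and> reg st 1 = 1"
proof -
  define D where "D = Suc N"
  define P Q S T where "P = row_len lam 0" and "Q = row_len lam 1"
    and "S = length lam - 2" and "T = column2 lam - 2"
  have len: "length lam \<le> N" using length_le_num_boxes[OF lam(1)] le by simp
  have "column2 lam \<le> length lam" by (simp add: column2_def)
  moreover have "P \<le> N" using row_len_0_le_num_boxes[of lam] le by (simp add: P_def)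
  moreover have "Q \<le> P" using row_len_antimono[OF lam(1), of 0 1] by (simp add: P_def Q_def)
  ultimately have digits: "P < D" "Q < D" "S < D" "T < D"
    using len by (auto simp: D_def S_def T_def)
  obtain s1 where s1:
    "terminates prepare (input_state lam N \<epsilon> \<delta>) (6 * length lam + 18 * D + 40) s1"
    "table_inv N (index D 0 P Q S T) s1"
    using terminates_prepare unfolding D_def P_def Q_def S_def T_def by blast
  obtain s2 where s2: "terminates table_loop s1 (100 * D ^ 5 + 1) s2"
    "table_inv N (index D 0 P Q S T) s2" "reg s2 15 = 0"
    using terminates_table_loop[OF s1(2)] unfolding D_def by blast
  let ?p = "[Sub 22 16 10, Add 22 22 21, Load 0 3 22, Const 1 1]"
  define s3 where "s3 = exec ?p s2"
  have t3: "terminates ?p s2 4 s3"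
    using terminates_exec[of ?p s2] by (simp add: s3_def eval_nat_numeral)
  \<comment> \<open>Register 15 is 0, so the layer is \<open>D\<close> and the lower and upper
    bounds on the position meet.\<close>
  have r16: "reg s2 16 = index D D 0 0 0 0"
  proof (rule antisym)
    show "reg s2 16 \<le> index D D 0 0 0 0"
      using s2(2) by (simp add: table_inv_def Let_def D_def)
    obtain v where "v + reg s2 15 = D"
      "reg s2 16 = index D v (reg s2 14) (reg s2 13) (reg s2 12) (reg s2 11)"
      using s2(2) unfolding table_inv_def Let_def D_def by blast
    then show "index D D 0 0 0 0 \<le> reg s2 16"
      using s2(3) by (simp add: index_layer_le)
  qed
  have inv: "reg s2 10 = D * D * D * D" "reg s2 21 = index D 0 P Q S T"
    "\<And>i. i < reg s2 16 \<Longrightarrow> arr s2 3 i = flat_walks D i"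
    using s2(2) by (simp_all add: table_inv_def Let_def D_def)
  have "reg s2 16 - reg s2 10 = index D N 0 0 0 0"
    unfolding r16 inv(1) using index_minus(1)[of D N 0 0 0 0] by (simp add: D_def)
  then have "reg s2 16 - reg s2 10 + reg s2 21 = index D N P Q S T"
    by (simp add: inv(2) index_def algebra_simps)
  moreover have "index D N P Q S T < reg s2 16"
    using index_less_next_layer[OF digits, of N] by (simp add: r16 D_def)
  ultimately have "reg s3 0 = walks N P Q S T"
    by (simp add: s3_def inv(3) flat_walks_index digits)
  then have "reg s3 0 = num_SVT lam N" "reg s3 1 = 1"
    using num_SVT_eq_walks[OF lam] by (simp_all add: s3_def P_def Q_def S_def T_def)
  moreover have "terminates svt_program (input_state lam N \<epsilon> \<delta>) (200 * D ^ 5) s3"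
    unfolding svt_program_def
  proof (rule terminates_mono[OF terminates_append[OF s1(1) terminates_append[OF s2(1) t3]]])
    have "1 \<le> D" by (simp add: D_def)
    then have "D ^ 1 \<le> D ^ 5" by (rule power_increasing[rotated]) simp
    \<comment> \<open>The terms other than \<open>100 * D ^ 5\<close> add up to at most
      \<open>69 * D\<close>.\<close>
    then show "6 * length lam + 18 * D + 40 + (100 * D ^ 5 + 1 + 4) \<le> 200 * D ^ 5"
      using len \<open>1 \<le> D\<close> D_def by simp
  qed
  ultimately show ?thesis unfolding D_def by blast
qed

theorem corollary1p3:
  "\<exists>p. is_FPRAS_SVT
         {(lam, N). is_partition lam \<and> partition_rank lam < 3 \<and> num_boxes lam \<le> N \<and> 0 < N} p"
proof (intro exI[of _ svt_program])
  have main: "(\<forall>cfg \<in> set_pmf (run n (svt_program, input_state lam N \<epsilon> \<delta>)). halted cfg) \<and>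
      measure_pmf.prob (run n (svt_program, input_state lam N \<epsilon> \<delta>))
        {cfg. (1 - \<epsilon>) * real (num_SVT lam N) \<le> result_value (snd cfg) \<and>
              result_value (snd cfg) \<le> (1 + \<epsilon>) * real (num_SVT lam N)} \<ge> 1 - \<delta>"
    if lam: "is_partition lam" "partition_rank lam < 3" "num_boxes lam \<le> N"
      and \<epsilon>: "\<epsilon> \<in> {0<..1}" and \<delta>: "\<delta> \<in> {0<..1}"
      and n: "n = nat \<lfloor>real 200 * (real (num_boxes lam) + real N + 1 / \<epsilon> + ln (1 / \<delta>)) ^ 5\<rfloor>"
    for lam N \<epsilon> \<delta> n
  proof -
    obtain st m where st: "reg st 0 = num_SVT lam N" "reg st 1 = 1"
      and m: "m \<le> 200 * Suc N ^ 5"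
      "\<And>q. run m (svt_program @ q, input_state lam N \<epsilon> \<delta>) = return_pmf (q, st)"
      using terminates_svt_program[OF lam] unfolding terminates_def by blast
    \<comment> \<open>\<open>1 / \<epsilon>\<close> supplies the extra 1 in
      \<open>Suc N\<close>.\<close>
    have "1 \<le> 1 / \<epsilon>" "0 \<le> ln (1 / \<delta>)" using \<epsilon> \<delta> by auto
    then have "real (Suc N) \<le> real (num_boxes lam) + real N + 1 / \<epsilon> + ln (1 / \<delta>)" by simp
    then have "real (Suc N) ^ 5 \<le> (real (num_boxes lam) + real N + 1 / \<epsilon> + ln (1 / \<delta>)) ^ 5"
      by (rule power_mono) simp
    then have "real (200 * Suc N ^ 5) \<le>
        real 200 * (real (num_boxes lam) + real N + 1 / \<epsilon> + ln (1 / \<delta>)) ^ 5"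
      by simp
    then have "200 * Suc N ^ 5 \<le> n" unfolding n by (rule le_nat_floor)
    then obtain r where r: "n = m + r" using m(1) le_trans le_Suc_ex by blast
    \<comment> \<open>A halted configuration is fixed by \<open>step\<close>, so the surplus
      \<open>r\<close> steps change nothing.\<close>
    have "run n (svt_program, input_state lam N \<epsilon> \<delta>) = return_pmf ([], st)"
      using m(2)[of "[]"] by (simp add: r run_add bind_return_pmf run_halted)
    moreover have "result_value st = real (num_SVT lam N)"
      by (simp add: result_value_def st del: One_nat_def)
    moreover have "(1 - \<epsilon>) * real (num_SVT lam N) \<le> real (num_SVT lam N)"
      "real (num_SVT lam N) \<le> (1 + \<epsilon>) * real (num_SVT lam N)"
      using \<epsilon> by (simp_all add: algebra_simps)
    ultimately show ?thesis
      using \<delta> by (simp add: halted_def)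
  qed
  show "is_FPRAS_SVT
      {(lam, N). is_partition lam \<and> partition_rank lam < 3 \<and> num_boxes lam \<le> N \<and> 0 < N} svt_program"
    unfolding is_FPRAS_SVT_def Let_def
    by (rule exI[of _ 200], rule exI[of _ 5], rule ballI, elim CollectE case_prodE conjE,
        hypsubst, unfold prod.case, intro ballI, rule main[OF _ _ _ _ _ refl])
qed

end
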